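(* Let $x_0\in\mathbb{R}^{n_x}$ be an initial condition and $u$ an input trajectory. Assume that $u$ is a weakly persistent input trajectory at $x_0$ and that all the associated $\mathcal{K}$-functions $\kappa_t$ have finite sensitivity. Then there exists $T>0$ such that for any $t\ge T$ there exist $\nu_t>0$, $R_t>0$, $K_t>0$ such that for any $\eta\in B_{t,\infty}(0,\nu_t)$ the problem $\inf_{\xi\in\mathbb{R}^{n_x}}\tilde{l}(t-T,t,\xi,u,\eta)$ has a unique local solution on $\overline{B}(x(t-T),R_t)$, denoted by $\xi^*_t(\eta)$, and it satisfies $$\|\xi^*_t(\eta)-x(t-T)\|\le K_t\,\|\eta\|_{t,T}.$$
   Context: Let $n_x,n_u,n_y$ be positive integers, $\mathbb{R}^+=[0,\infty)$, $U\subset\mathbb{R}^{n_u}$, and $f:\mathbb{R}^{n_x}\times\mathbb{R}^{n_u}\to\mathbb{R}^{n_x}$, $h:\mathbb{R}^{n_x}\times\mathbb{R}^{n_u}\to\mathbb{R}^{n_y}$ be twice continuously differentiable. The system is $\dot{x}=f(x,u)$, $y=h(x,u)$. An input trajectory is a piecewise continuous map $u:\mathbb{R}^+\to U$. Solutions are assumed to be uniquely defined at all times; $\phi_f(s_2;s_1,\xi,u)$ is the solution at time $s_2\ge s_1\ge 0$ starting from $\xi$ at time $s_1$ with input $u$. The reference trajectory is $x(t)=\phi_f(t;0,x_0,u)$. $\|\cdot\|$ is the Euclidean norm; $\overline{B}(a,R)$ is the closed Euclidean ball. Cumulative output error: for $0\le t_1\le t_2$, $$l(t_1,t_2,\xi_1,\xi_2,u)=\int_{t_1}^{t_2}\|h(\phi_f(s;t_1,\xi_1,u),u(s))-h(\phi_f(s;t_1,\xi_2,u),u(s))\|^2\,\mathrm{d}s.$$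 A $\mathcal{K}$-function is a continuous strictly increasing $\kappa:\mathbb{R}^+\to\mathbb{R}$ with $\kappa(0)=0$. It has finite sensitivity if there is $r>0$ with $\inf_{0<\|\xi\|\le r}\kappa(\|\xi\|)/\|\xi\|^2>0$. $u$ is weakly persistent at $x_0$ if there exists $T>0$ such that for any $t\ge T$ there exist $R_t>0$ and a $\mathcal{K}$-function $\kappa_t$ (the associated $\mathcal{K}$-functions) such that for any $\xi_1,\xi_2\in\overline{B}(x(t-T),R_t)$: $l(t-T,t,\xi_1,\xi_2,u)\ge\kappa_t(\|\xi_1-\xi_2\|)$. Perturbations: $L_\infty(I,\mathbb{R}^n)$ is the Banach space of (essentially) bounded measurable functions on the interval $I$ with norm $\|\cdot\|_{\infty,I}$. For $T>0$, $t\ge T$: $\Theta_{t,T}=L_\infty([t-T,t],\mathbb{R}^{n_y})\times L_\infty([0,t],\mathbb{R}^{n_x})$ with $\|\eta\|_{t,T}=\max(\|v\|_{\infty,[t-T,t]},\|w\|_{\infty,[0,t]})$ for $\eta=(v,w)$; $B_{t,\infty}(0,\nu)$ is the open ball of $\Theta_{t,T}$. For a process noise $w$, the perturbed dynamics $\dot{x}(s)=f(x(s),u(s))+w(s)$ (satisfied almost everywhere), $x(s_1)=\xi$, are assumed to have a uniquely defined solution at all times considered, denoted $\tilde\phi_f(s;s_1,\xi,u,w)$; the perturbed reference trajectory is $\tilde{x}(s,w)=\tilde\phi_f(s;0,x_0,u,w)$. Perturbed moving horizon cost: for $\eta=(v,w)\in\Theta_{t,T}$, $$\tilde{l}(t-T,t,\xi,u,\eta)=\int_{t-T}^{t}\|h(\tilde{x}(s,w),u(s))+v(s)-h(\phi_f(s;t-T,\xi,u),u(s))\|^2\,\mathrm{d}s.$$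 A local solution of $\inf_{\xi}F(\xi)$ is a point $\xi^*\in\mathbb{R}^{n_x}$ having a neighbourhood $\mathbb{U}$ such that $F(\xi^* )\le F(\xi)$ for all $\xi\in\mathbb{U}$. *)

theory Defs
  imports "HOL-Analysis.Analysis" "HOL-Probability.Essential_Supremum"
begin

section \<open>Data of the system\<close>

definition C2 :: "('a::real_normed_vector \<Rightarrow> 'b::real_normed_vector) \<Rightarrow> bool" where
  "C2 g \<longleftrightarrow>
     (\<exists>(g' :: 'a \<Rightarrow> 'a \<Rightarrow>\<^sub>L 'b) (g'' :: 'a \<Rightarrow> 'a \<Rightarrow>\<^sub>L 'a \<Rightarrow>\<^sub>L 'b).
        (\<forall>z. (g has_derivative blinfun_apply (g' z)) (at z)) \<and>
        (\<forall>z. (g' has_derivative blinfun_apply (g'' z)) (at z)) \<and>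
        continuous_on UNIV g'')"

text \<open>Usual convention: finitely many discontinuities on each compact subinterval of
  \<open>[0, \<infinity>)\<close>, and finite one-sided limits everywhere. Values on negative reals are irrelevant.\<close>

definition piecewise_continuous :: "(real \<Rightarrow> 'a::topological_space) \<Rightarrow> bool" where
  "piecewise_continuous u \<longleftrightarrow>
     (\<forall>b\<ge>0. finite {s \<in> {0..b}. \<not> continuous (at s within {0..}) u}) \<and>
     (\<forall>s\<ge>0. \<exists>l. (u \<longlongrightarrow> l) (at_right s)) \<and>
     (\<forall>s>0. \<exists>l. (u \<longlongrightarrow> l) (at_left s))"

definition input_trajectory :: "'a::topological_space set \<Rightarrow> (real \<Rightarrow> 'a) \<Rightarrow> bool" where
  "input_trajectory U u \<longleftrightarrow> (\<forall>s\<ge>0. u s \<in> U) \<and> piecewise_continuous u"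

section \<open>Solutions\<close>

text \<open>Absolute continuity on \<open>[a, b]\<close>. The family \<open>D\<close> is a finite set of compact intervals with
  disjoint interiors; for \<open>K = [c, d]\<close> the summands are \<open>d - c\<close> and \<open>\<parallel>x d - x c\<parallel>\<close>.\<close>

definition abs_continuous_on :: "real \<Rightarrow> real \<Rightarrow> (real \<Rightarrow> 'a::real_normed_vector) \<Rightarrow> bool" where
  "abs_continuous_on a b x \<longleftrightarrow>
     (\<forall>\<epsilon>>0. \<exists>\<delta>>0. \<forall>D S. D division_of S \<and> S \<subseteq> {a..b} \<and> (\<Sum>K\<in>D. measure lborel K) < \<delta> \<longrightarrow>
        (\<Sum>K\<in>D. norm (x (Sup K) - x (Inf K))) < \<epsilon>)"

text \<open>Solution on \<open>[s1, s2]\<close> of \<open>x' = f(x, u) + w\<close>, \<open>x(s1) = \<xi>\<close>, in the sense of Caratheodory: an absolutely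
  continuous function satisfying the equation almost everywhere. The unperturbed dynamics
  are the case \<open>w = 0\<close>.\<close>

definition solves_on ::
  "((real^'n) \<times> (real^'m) \<Rightarrow> real^'n) \<Rightarrow> (real \<Rightarrow> real^'m) \<Rightarrow> (real \<Rightarrow> real^'n)
    \<Rightarrow> real \<Rightarrow> real \<Rightarrow> real^'n \<Rightarrow> (real \<Rightarrow> real^'n) \<Rightarrow> bool" where
  "solves_on f u w s1 s2 \<xi> x \<longleftrightarrow>
     x s1 = \<xi> \<and> abs_continuous_on s1 s2 x \<and>
     (AE s in lebesgue_on {s1..s2}.
        (x has_vector_derivative f (x s, u s) + w s) (at s within {s1..s2}))"

definition uniquely_solvable ::
  "((real^'n) \<times> (real^'m) \<Rightarrow> real^'n) \<Rightarrow> (real \<Rightarrow> real^'m) \<Rightarrow> (real \<Rightarrow> real^'n)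
    \<Rightarrow> real \<Rightarrow> real \<Rightarrow> real^'n \<Rightarrow> bool" where
  "uniquely_solvable f u w s1 s2 \<xi> \<longleftrightarrow>
     (\<exists>x. solves_on f u w s1 s2 \<xi> x) \<and>
     (\<forall>x y. solves_on f u w s1 s2 \<xi> x \<and> solves_on f u w s1 s2 \<xi> y \<longrightarrow> (\<forall>s\<in>{s1..s2}. x s = y s))"

text \<open>The value at \<open>s2\<close> of the solution; only meaningful under \<^const>\<open>uniquely_solvable\<close>.\<close>

definition pert_flow ::
  "((real^'n) \<times> (real^'m) \<Rightarrow> real^'n) \<Rightarrow> real \<Rightarrow> real \<Rightarrow> real^'n
    \<Rightarrow> (real \<Rightarrow> real^'m) \<Rightarrow> (real \<Rightarrow> real^'n) \<Rightarrow> real^'n" where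
  "pert_flow f s2 s1 \<xi> u w = (THE z. \<exists>x. solves_on f u w s1 s2 \<xi> x \<and> x s2 = z)"

definition flow ::
  "((real^'n) \<times> (real^'m) \<Rightarrow> real^'n) \<Rightarrow> real \<Rightarrow> real \<Rightarrow> real^'n \<Rightarrow> (real \<Rightarrow> real^'m) \<Rightarrow> real^'n" where
  "flow f s2 s1 \<xi> u = pert_flow f s2 s1 \<xi> u (\<lambda>_. 0)"

section \<open>Perturbations\<close>

text \<open>Elements of \<open>L\<^sub>\<infinity>\<close> are represented by functions defined on all reals, of which only the
  restriction to \<open>I\<close>, up to null sets, matters.\<close>

definition Linf :: "real set \<Rightarrow> (real \<Rightarrow> 'a::real_normed_vector) set" where
  "Linf I = {g \<in> borel_measurable (lebesgue_on I).
               esssup (lebesgue_on I) (\<lambda>s. ereal (norm (g s))) < \<infinity>}"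

definition Linf_norm :: "real set \<Rightarrow> (real \<Rightarrow> 'a::real_normed_vector) \<Rightarrow> real" where
  "Linf_norm I g = real_of_ereal (esssup (lebesgue_on I) (\<lambda>s. ereal (norm (g s))))"

definition Theta :: "real \<Rightarrow> real \<Rightarrow> ((real \<Rightarrow> real^'p) \<times> (real \<Rightarrow> real^'n)) set" where
  "Theta t T = Linf {t-T..t} \<times> Linf {0..t}"

definition Theta_norm :: "real \<Rightarrow> real \<Rightarrow> (real \<Rightarrow> real^'p) \<times> (real \<Rightarrow> real^'n) \<Rightarrow> real" where
  "Theta_norm t T \<eta> = max (Linf_norm {t-T..t} (fst \<eta>)) (Linf_norm {0..t} (snd \<eta>))"

definition Theta_ball :: "real \<Rightarrow> real \<Rightarrow> real \<Rightarrow> ((real \<Rightarrow> real^'p) \<times> (real \<Rightarrow> real^'n)) set" where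
  "Theta_ball t T \<nu> = {\<eta> \<in> Theta t T. Theta_norm t T \<eta> < \<nu>}"

section \<open>Output error and moving horizon cost\<close>

definition output_error ::
  "((real^'n) \<times> (real^'m) \<Rightarrow> real^'n) \<Rightarrow> ((real^'n) \<times> (real^'m) \<Rightarrow> real^'p)
    \<Rightarrow> real \<Rightarrow> real \<Rightarrow> real^'n \<Rightarrow> real^'n \<Rightarrow> (real \<Rightarrow> real^'m) \<Rightarrow> real" where
  "output_error f h t1 t2 \<xi>1 \<xi>2 u =
     (LINT s:{t1..t2}|lebesgue.
        (norm (h (flow f s t1 \<xi>1 u, u s) - h (flow f s t1 \<xi>2 u, u s)))\<^sup>2)"

definition mh_cost ::
  "((real^'n) \<times> (real^'m) \<Rightarrow> real^'n) \<Rightarrow> ((real^'n) \<times> (real^'m) \<Rightarrow> real^'p) \<Rightarrow> real^'n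
    \<Rightarrow> real \<Rightarrow> real \<Rightarrow> real^'n \<Rightarrow> (real \<Rightarrow> real^'m) \<Rightarrow> (real \<Rightarrow> real^'p) \<times> (real \<Rightarrow> real^'n) \<Rightarrow> real" where
  "mh_cost f h x0 t1 t2 \<xi> u \<eta> =
     (LINT s:{t1..t2}|lebesgue.
        (norm (h (pert_flow f s 0 x0 u (snd \<eta>), u s) + fst \<eta> s - h (flow f s t1 \<xi> u, u s)))\<^sup>2)"

definition local_solution :: "('a::topological_space \<Rightarrow> real) \<Rightarrow> 'a \<Rightarrow> bool" where
  "local_solution F \<xi> \<longleftrightarrow> (\<exists>N. open N \<and> \<xi> \<in> N \<and> (\<forall>\<zeta>\<in>N. F \<xi> \<le> F \<zeta>))"

section \<open>Weak persistence\<close>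

definition K_function :: "(real \<Rightarrow> real) \<Rightarrow> bool" where
  "K_function \<kappa> \<longleftrightarrow> continuous_on {0..} \<kappa> \<and> strict_mono_on {0..} \<kappa> \<and> \<kappa> 0 = 0"

text \<open>The type argument selects the space over which \<open>\<xi>\<close> ranges. For \<^const>\<open>K_function\<close>s the
  infimum is taken over a nonempty set of positive reals, so it is the genuine infimum.\<close>

definition finite_sensitivity :: "'n::finite itself \<Rightarrow> (real \<Rightarrow> real) \<Rightarrow> bool" where
  "finite_sensitivity _ \<kappa> \<longleftrightarrow>
     (\<exists>r>0. (INF \<xi>\<in>{\<xi>::real^'n. 0 < norm \<xi> \<and> norm \<xi> \<le> r}. \<kappa> (norm \<xi>) / (norm \<xi>)\<^sup>2) > 0)"

text \<open>Weak persistence of \<open>u\<close> at \<open>x0\<close> is \<open>\<exists>T R \<kappa>. weakly_persistent_with f h x0 u T R \<kappa>\<close>. The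
  witnesses are exposed so that further conditions can be put on the associated functions \<open>\<kappa> t\<close>.\<close>

definition weakly_persistent_with ::
  "((real^'n) \<times> (real^'m) \<Rightarrow> real^'n) \<Rightarrow> ((real^'n) \<times> (real^'m) \<Rightarrow> real^'p) \<Rightarrow> real^'n
    \<Rightarrow> (real \<Rightarrow> real^'m) \<Rightarrow> real \<Rightarrow> (real \<Rightarrow> real) \<Rightarrow> (real \<Rightarrow> real \<Rightarrow> real) \<Rightarrow> bool" where
  "weakly_persistent_with f h x0 u T R \<kappa> \<longleftrightarrow>
     T > 0 \<and>
     (\<forall>t\<ge>T. R t > 0 \<and> K_function (\<kappa> t) \<and>
        (\<forall>\<xi>1 \<in> cball (flow f (t-T) 0 x0 u) (R t). \<forall>\<xi>2 \<in> cball (flow f (t-T) 0 x0 u) (R t).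
           output_error f h (t-T) t \<xi>1 \<xi>2 u \<ge> \<kappa> t (norm (\<xi>1 - \<xi>2))))"

end

theory Submission
  imports Defs
begin

text \<open>The flow is never differentiated. Gronwall's inequality shows that \<open>\<xi> \<mapsto> \<phi>(s; \<xi>)\<close>, and hence the
  output \<open>H \<xi> s = h(\<phi>(s; \<xi>), u s)\<close>, is Lipschitz near \<open>x(t-T)\<close> and fails to be affine only to second
  order: \<open>\<parallel>H((1-l)\<xi> + l\<zeta>) - (1-l)H \<xi> - l H \<zeta>\<parallel> \<le> C l(1-l)\<parallel>\<xi> - \<zeta>\<parallel>\<^sup>2\<close>. Weak persistence with finite
  sensitivity gives \<open>\<integral>\<parallel>H \<xi> - H \<zeta>\<parallel>\<^sup>2 \<ge> c\<parallel>\<xi> - \<zeta>\<parallel>\<^sup>2\<close>. In \<open>\<integral>\<parallel>Y - H \<xi>\<parallel>\<^sup>2\<close> the defect of affinity is multiplied by the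
  residual, so where the residual is small the quadratic term wins and the cost is strongly convex.
  Its minimizer over a small ball is the only local solution there, and comparing its cost with that of
  \<open>x(t-T)\<close>, which is of order \<open>\<parallel>\<eta>\<parallel>\<^sup>2\<close>, bounds its distance to \<open>x(t-T)\<close> and keeps it in the interior.\<close>

section \<open>Absolutely continuous functions\<close>

text \<open>Three obstacles shape the estimates. Disturbances are merely essentially bounded, so
  solutions satisfy the equation only almost everywhere; increments are recovered from derivatives
  through absolute continuity and the gauge integral, which supplies integrability of the derivative
  along the way. Second, the constants of \<open>f\<close> and \<open>h\<close> hold on bounded sets
  only, so solutions must first be confined to a tube around the reference, by a smallness condition
  with unit margin. Third, noise and distance from the reference state both enlarge the residual:
  with data error \<delta> on a ball of radius \<open>R\<close> it is at most
  \<open>\<delta> + C * R\<close>. Hence \<open>R\<close> is fixed first, from the persistence and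
  model constants, and the noise level afterwards, relative to \<open>R\<close>. The weight
  \<open>l * (1 - l)\<close> in the defect is essential: the gain from convexity of the squared norm
  carries the same weight, so gain and loss compare uniformly in \<open>l\<close>. Both are
  quadratic in the distance of the two initial states, which is why a quadratic lower bound on the
  output error is the right one.\<close>

lemma sum_content_division_le:
  fixes D :: "real set set"
  assumes D: "D division_of S" and "S \<subseteq> W" and W: "W \<in> lmeasurable"
  shows "(\<Sum>K\<in>D. measure lborel K) \<le> measure lebesgue W"
proof -
  \<comment> \<open>The integral of 1 adds up over the non-overlapping intervals, so the total
    length becomes the measure of \<open>S\<close> and monotonicity of measure applies.\<close>
  have "((\<lambda>_. 1::real) has_integral (\<Sum>K\<in>D. measure lborel K)) S"
  proof (rule has_integral_combine_division[OF D])
    fix K assume "K \<in> D"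
    then obtain c d where K: "K = cbox c d" using D by (meson division_ofD(4))
    show "((\<lambda>_. 1::real) has_integral measure lborel K) K"
      using has_integral_const[of "1::real" c d] K by simp
  qed
  then have 1: "S \<in> lmeasurable" "(\<Sum>K\<in>D. measure lborel K) = integral S (\<lambda>_. 1::real)"
    by (auto simp: lmeasurable_iff_integrable_on integrable_on_def integral_unique)
  then have "(\<Sum>K\<in>D. measure lborel K) = measure lebesgue S"
    by (simp add: lmeasure_integral)
  also have "\<dots> \<le> measure lebesgue W"
    using 1 W assms(2) by (intro measure_mono_fmeasurable) (auto simp: fmeasurableD)
  finally show ?thesis .
qed

lemma abs_continuous_onD:
  assumes "abs_continuous_on a b x" "\<epsilon> > 0"
  obtains \<delta> where "\<delta> > 0"
    "\<And>D S. D division_of S \<Longrightarrow> S \<subseteq> {a..b} \<Longrightarrow> (\<Sum>K\<in>D. measure lborel K) < \<delta> \<Longrightarrow>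
       (\<Sum>K\<in>D. norm (x (Sup K) - x (Inf K))) < \<epsilon>"
  using assms unfolding abs_continuous_on_def by meson

lemma abs_continuous_on_subinterval:
  assumes "abs_continuous_on a b x" "a \<le> c" "d \<le> b"
  shows "abs_continuous_on c d x"
  unfolding abs_continuous_on_def
proof (intro allI impI)
  fix \<epsilon>::real assume "\<epsilon> > 0"
  obtain \<delta> where "\<delta> > 0" and \<delta>: "\<And>D S. D division_of S \<Longrightarrow> S \<subseteq> {a..b} \<Longrightarrow>
      (\<Sum>K\<in>D. measure lborel K) < \<delta> \<Longrightarrow> (\<Sum>K\<in>D. norm (x (Sup K) - x (Inf K))) < \<epsilon>"
    using abs_continuous_onD[OF assms(1) \<open>\<epsilon> > 0\<close>] by blast
  have "{c..d} \<subseteq> {a..b}" using assms by auto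
  then show "\<exists>\<delta>>0. \<forall>D S. D division_of S \<and> S \<subseteq> {c..d} \<and> (\<Sum>K\<in>D. measure lborel K) < \<delta> \<longrightarrow>
      (\<Sum>K\<in>D. norm (x (Sup K) - x (Inf K))) < \<epsilon>"
    using \<open>\<delta> > 0\<close> by (intro exI[of _ \<delta>]) (auto intro!: \<delta> dest: order_trans)
qed

lemma abs_continuous_on_add:
  assumes "abs_continuous_on a b x" "abs_continuous_on a b y"
  shows "abs_continuous_on a b (\<lambda>s. x s + y s)"
  unfolding abs_continuous_on_def
proof (intro allI impI)
  fix \<epsilon>::real assume "\<epsilon> > 0"
  then have e: "\<epsilon>/2 > 0" by simp
  obtain \<delta>1 where "\<delta>1 > 0" and 1: "\<And>D S. D division_of S \<Longrightarrow> S \<subseteq> {a..b} \<Longrightarrow>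
      (\<Sum>K\<in>D. measure lborel K) < \<delta>1 \<Longrightarrow> (\<Sum>K\<in>D. norm (x (Sup K) - x (Inf K))) < \<epsilon>/2"
    using abs_continuous_onD[OF assms(1) e] by blast
  obtain \<delta>2 where "\<delta>2 > 0" and 2: "\<And>D S. D division_of S \<Longrightarrow> S \<subseteq> {a..b} \<Longrightarrow>
      (\<Sum>K\<in>D. measure lborel K) < \<delta>2 \<Longrightarrow> (\<Sum>K\<in>D. norm (y (Sup K) - y (Inf K))) < \<epsilon>/2"
    using abs_continuous_onD[OF assms(2) e] by blast
  show "\<exists>\<delta>>0. \<forall>D S. D division_of S \<and> S \<subseteq> {a..b} \<and> (\<Sum>K\<in>D. measure lborel K) < \<delta> \<longrightarrow>
      (\<Sum>K\<in>D. norm (x (Sup K) + y (Sup K) - (x (Inf K) + y (Inf K)))) < \<epsilon>"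
  proof (intro exI[of _ "min \<delta>1 \<delta>2"] conjI allI impI)
    fix D :: "real set set" and S
    assume D: "D division_of S \<and> S \<subseteq> {a..b} \<and> (\<Sum>K\<in>D. measure lborel K) < min \<delta>1 \<delta>2"
    have "(\<Sum>K\<in>D. norm (x (Sup K) + y (Sup K) - (x (Inf K) + y (Inf K))))
        \<le> (\<Sum>K\<in>D. norm (x (Sup K) - x (Inf K)) + norm (y (Sup K) - y (Inf K)))"
      by (intro sum_mono norm_diff_triangle_ineq)
    also have "\<dots> < \<epsilon>/2 + \<epsilon>/2"
      unfolding sum.distrib using D by (intro add_strict_mono 1 2) auto
    finally show "(\<Sum>K\<in>D. norm (x (Sup K) + y (Sup K) - (x (Inf K) + y (Inf K)))) < \<epsilon>" by simp
  qed (use \<open>\<delta>1 > 0\<close> \<open>\<delta>2 > 0\<close> in auto)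
qed

lemma abs_continuous_on_scaleR:
  assumes "abs_continuous_on a b x"
  shows "abs_continuous_on a b (\<lambda>s. c *\<^sub>R x s)"
  unfolding abs_continuous_on_def
proof (intro allI impI)
  fix \<epsilon>::real assume "\<epsilon> > 0"
  \<comment> \<open>The added 1 keeps the tolerance positive when \<open>c = 0\<close>.\<close>
  then have e: "\<epsilon> / (\<bar>c\<bar> + 1) > 0" by simp
  obtain \<delta> where "\<delta> > 0" and \<delta>: "\<And>D S. D division_of S \<Longrightarrow> S \<subseteq> {a..b} \<Longrightarrow>
      (\<Sum>K\<in>D. measure lborel K) < \<delta> \<Longrightarrow> (\<Sum>K\<in>D. norm (x (Sup K) - x (Inf K))) < \<epsilon> / (\<bar>c\<bar> + 1)"
    using abs_continuous_onD[OF assms(1) e] by blast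
  show "\<exists>\<delta>>0. \<forall>D S. D division_of S \<and> S \<subseteq> {a..b} \<and> (\<Sum>K\<in>D. measure lborel K) < \<delta> \<longrightarrow>
      (\<Sum>K\<in>D. norm (c *\<^sub>R x (Sup K) - c *\<^sub>R x (Inf K))) < \<epsilon>"
  proof (intro exI[of _ \<delta>] conjI allI impI)
    fix D :: "real set set" and S
    assume D: "D division_of S \<and> S \<subseteq> {a..b} \<and> (\<Sum>K\<in>D. measure lborel K) < \<delta>"
    let ?s = "\<Sum>K\<in>D. norm (x (Sup K) - x (Inf K))"
    have "(\<Sum>K\<in>D. norm (c *\<^sub>R x (Sup K) - c *\<^sub>R x (Inf K))) = \<bar>c\<bar> * ?s"
      by (simp add: sum_distrib_left flip: scaleR_diff_right)
    also have "\<dots> \<le> (\<bar>c\<bar> + 1) * ?s" by (intro mult_right_mono sum_nonneg) auto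
    also have "\<dots> < \<epsilon>" using \<delta>[of D S] D by (simp add: field_simps)
    finally show "(\<Sum>K\<in>D. norm (c *\<^sub>R x (Sup K) - c *\<^sub>R x (Inf K))) < \<epsilon>" .
  qed fact
qed

lemma abs_continuous_on_diff:
  assumes "abs_continuous_on a b x" "abs_continuous_on a b y"
  shows "abs_continuous_on a b (\<lambda>s. x s - y s)"
  using abs_continuous_on_add[OF assms(1) abs_continuous_on_scaleR[OF assms(2), of "-1"]] by simp

lemma abs_continuous_on_imp_continuous_on:
  assumes "abs_continuous_on a b x"
  shows "continuous_on {a..b} x"
  unfolding continuous_on_iff
proof (intro ballI allI impI)
  fix s and \<epsilon> :: real assume s: "s \<in> {a..b}" and "\<epsilon> > 0"
  obtain \<delta> where "\<delta> > 0" and \<delta>: "\<And>D S. D division_of S \<Longrightarrow> S \<subseteq> {a..b} \<Longrightarrow>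
      (\<Sum>K\<in>D. measure lborel K) < \<delta> \<Longrightarrow> (\<Sum>K\<in>D. norm (x (Sup K) - x (Inf K))) < \<epsilon>"
    using abs_continuous_onD[OF assms(1) \<open>\<epsilon> > 0\<close>] by blast
  have *: "norm (x d - x c) < \<epsilon>" if "c \<le> d" "c \<in> {a..b}" "d \<in> {a..b}" "d - c < \<delta>" for c d
    using \<delta>[of "{{c..d}}" "{c..d}"] that division_of_self[of c d] by auto
  show "\<exists>d>0. \<forall>x'\<in>{a..b}. dist x' s < d \<longrightarrow> dist (x x') (x s) < \<epsilon>"
  proof (intro exI[of _ \<delta>] conjI ballI impI)
    fix s' assume "s' \<in> {a..b}" "dist s' s < \<delta>"
    then show "dist (x s') (x s) < \<epsilon>"
      using *[of s s'] *[of s' s] s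
      by (cases "s \<le> s'") (auto simp: dist_norm norm_minus_commute)
  qed fact
qed

lemma AE_lebesgue_on_negligible:
  assumes "AE s in lebesgue_on S. P s" "S \<in> sets lebesgue"
  obtains N where "negligible N" "\<And>s. s \<in> S - N \<Longrightarrow> P s"
proof -
  have "AE s in lebesgue. s \<in> S \<longrightarrow> P s"
    using assms by (simp add: AE_restrict_space_iff)
  then obtain N where "N \<in> null_sets lebesgue" "{s. \<not> (s \<in> S \<longrightarrow> P s)} \<subseteq> N"
    by (auto simp: eventually_ae_filter)
  then show ?thesis using that[of N] by (auto simp: negligible_iff_null_sets)
qed

text \<open>On the exceptional null set the gauge stays inside an open set of small measure, and absolute
  continuity controls the increments there.\<close>

lemma abs_continuous_on_has_integral:
  fixes x :: "real \<Rightarrow> 'a::banach"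
  assumes ac: "abs_continuous_on a b x" and "a \<le> b" and N: "negligible N"
    and der: "\<And>s. s \<in> {a..b} - N \<Longrightarrow> (x has_vector_derivative g s) (at s within {a..b})"
  shows "(g has_integral (x b - x a)) {a..b}"
proof (rule has_integral_spike[OF N])
  \<comment> \<open>Nothing is known about \<open>g\<close> on \<open>N\<close>; the value 0 reduces
    the Riemann terms tagged there to bare increments of \<open>x\<close>.\<close>
  let ?g = "\<lambda>s. if s \<in> N then 0 else g s"
  show "\<And>s. s \<in> {a..b} - N \<Longrightarrow> g s = ?g s" by auto
  have "(?g has_integral (x b - x a)) (cbox a b)"
    unfolding has_integral
  proof (intro allI impI)
    fix e :: real assume "e > 0"
    \<comment> \<open>Half of \<open>e\<close> pays for the tags outside \<open>N\<close>, at rate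
      \<open>e1\<close> per unit length, the other half for the tags in \<open>N\<close>; the
      \<open>+ 1\<close> covers \<open>a = b\<close>.\<close>
    define e1 where "e1 = e / (2 * (b - a + 1))"
    have "e1 > 0" unfolding e1_def using \<open>e > 0\<close> \<open>a \<le> b\<close> by simp
    have e1: "e1 * (b - a) \<le> e / 2"
      unfolding e1_def using \<open>e > 0\<close> \<open>a \<le> b\<close> by (simp add: field_simps)
    have "\<forall>s. \<exists>d>0. s \<in> {a..b} - N \<longrightarrow>
         (\<forall>y\<in>{a..b}. norm (y-s) < d \<longrightarrow> norm (x y - x s - (y-s) *\<^sub>R g s) \<le> e1 * norm (y-s))"
      using der[unfolded has_vector_derivative_def has_derivative_within_alt] \<open>e1 > 0\<close>
      by (metis zero_less_one)
    then obtain d where d: "\<And>s. 0 < d s"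
      "\<And>s y. \<lbrakk>s \<in> {a..b} - N; y \<in> {a..b}; norm (y-s) < d s\<rbrakk>
              \<Longrightarrow> norm (x y - x s - (y-s) *\<^sub>R g s) \<le> e1 * norm (y-s)"
      by metis
    obtain \<delta> where "\<delta> > 0" and \<delta>: "\<And>D S. D division_of S \<Longrightarrow> S \<subseteq> {a..b} \<Longrightarrow>
      (\<Sum>K\<in>D. measure lborel K) < \<delta> \<Longrightarrow> (\<Sum>K\<in>D. norm (x (Sup K) - x (Inf K))) < e/2"
      using abs_continuous_onD[OF ac, of "e/2"] \<open>e > 0\<close> by auto
    obtain W where W: "open W" "N \<subseteq> W" "W \<in> lmeasurable" "measure lebesgue W < \<delta>"
    proof -
      have "N \<in> sets lebesgue" using N negligible_iff_null_sets by blast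
      then obtain W where W: "open W" "N \<subseteq> W" "W - N \<in> lmeasurable"
          "emeasure lebesgue (W - N) < ennreal \<delta>"
        using sets_lebesgue_outer_open[OF _ \<open>\<delta> > 0\<close>] by metis
      have "W = (W - N) \<union> N" using W by auto
      moreover have "measure lebesgue (W - N) < \<delta>"
        using W(3,4) \<open>\<delta> > 0\<close> by (simp add: emeasure_eq_measure2 ennreal_less_iff)
      moreover have "measure lebesgue ((W - N) \<union> N) \<le> measure lebesgue (W - N) + measure lebesgue N"
        using W(3) \<open>N \<in> sets lebesgue\<close> by (intro measure_Un_le) (auto simp: fmeasurableD)
      ultimately have "measure lebesgue W < \<delta>" "W \<in> lmeasurable"
        using negligible_imp_measure0[OF N] fmeasurable.Un[OF W(3) negligible_imp_measurable[OF N]]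
        by auto
      then show ?thesis using that W by blast
    qed
    define \<gamma> where "\<gamma> = (\<lambda>s. if s \<in> N then W else ball s (d s))"
    show "\<exists>\<gamma>. gauge \<gamma> \<and> (\<forall>p. p tagged_division_of cbox a b \<and> \<gamma> fine p \<longrightarrow>
            norm ((\<Sum>(s, K)\<in>p. measure lborel K *\<^sub>R ?g s) - (x b - x a)) < e)"
    proof (intro exI[of _ \<gamma>] conjI allI impI)
      show "gauge \<gamma>" unfolding gauge_def \<gamma>_def using W d by auto
      fix p assume p: "p tagged_division_of cbox a b \<and> \<gamma> fine p"
      have fin: "finite p" using p by blast
      define q where "q = {sK \<in> p. fst sK \<in> N}"
      have "q \<subseteq> p" unfolding q_def by auto
      have q: "q tagged_partial_division_of cbox a b"
        using p \<open>q \<subseteq> p\<close> tagged_partial_division_subset tagged_division_of_def by blast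
      let ?t = "\<lambda>(s, K). measure lborel K *\<^sub>R ?g s - (x (Sup K) - x (Inf K))"
      have eq: "(\<Sum>(s, K)\<in>p. measure lborel K *\<^sub>R ?g s) - (x b - x a) = sum ?t (p - q) + sum ?t q"
      proof -
        have "x b - x a = (\<Sum>(s,K)\<in>p. x (Sup K) - x (Inf K))"
          using additive_tagged_division_1[OF \<open>a \<le> b\<close>, of p x] p by simp
        then have "(\<Sum>(s, K)\<in>p. measure lborel K *\<^sub>R ?g s) - (x b - x a) = sum ?t p"
          by (simp add: sum_subtractf case_prod_unfold)
        then show ?thesis using sum.subset_diff[OF \<open>q \<subseteq> p\<close> fin, of ?t] by simp
      qed
      have 1: "norm (sum ?t (p - q)) \<le> e/2"
      proof -
        have "norm (sum ?t (p - q)) \<le> (\<Sum>(s,K)\<in>p - q. e1 * measure lborel K)"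
        proof (rule sum_norm_le, clarify)
          fix s K assume sK: "(s, K) \<in> p" "(s, K) \<notin> q"
          then have sN: "s \<notin> N" by (auto simp: q_def)
          obtain u v where K: "K = cbox u v" and "s \<in> K" and kab: "K \<subseteq> cbox a b"
            using p sK by (metis tagged_division_ofD(2-4))
          then have "u \<le> v" by auto
          have "K \<subseteq> \<gamma> s" using p sK by (auto simp: fine_def)
          then have ball: "\<forall>y\<in>K. norm (y - s) < d s"
            using sN by (auto simp: \<gamma>_def dist_norm norm_minus_commute)
          have uv: "u \<in> K" "v \<in> K" by (simp_all add: \<open>u \<le> v\<close> K)
          have "norm ((v - u) *\<^sub>R g s - (x v - x u))
              = norm (x u - x s - (u - s) *\<^sub>R g s - (x v - x s - (v - s) *\<^sub>R g s))"
            by (auto simp: algebra_simps)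
          also have "\<dots> \<le> norm (x u - x s - (u - s) *\<^sub>R g s) + norm (x v - x s - (v - s) *\<^sub>R g s)"
            by (rule norm_triangle_ineq4)
          also have "\<dots> \<le> e1 * norm (u - s) + e1 * norm (v - s)"
            using uv kab \<open>s \<in> K\<close> sN ball by (intro add_mono d(2)) auto
          also have "\<dots> = e1 * (v - u)"
            using \<open>s \<in> K\<close> K by (auto simp: algebra_simps)
          finally show "norm (measure lborel K *\<^sub>R ?g s - (x (Sup K) - x (Inf K))) \<le> e1 * measure lborel K"
            using sN K \<open>u \<le> v\<close> by simp
        qed
        also have "\<dots> \<le> (\<Sum>(s,K)\<in>p. e1 * measure lborel K)"
          using fin \<open>e1 > 0\<close> by (intro sum_mono2) auto
        also have "\<dots> = e1 * (b - a)"
          using additive_content_tagged_division[of p a b] p \<open>a \<le> b\<close>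
          by (simp add: case_prod_unfold flip: sum_distrib_left)
        finally show ?thesis using e1 by simp
      qed
      have 2: "norm (sum ?t q) < e/2"
      proof -
        have nonempty: "K \<noteq> {}" if "(s, K) \<in> q" for s K
          using tagged_partial_division_ofD(2)[OF q that] by auto
        \<comment> \<open>Replacing tagged pairs by their intervals requires a summand that vanishes
          on intervals without interior, since only those can carry several tags. One-point
          intervals satisfy this because \<open>Sup\<close> and \<open>Inf\<close> agree; for
          \<open>{}\<close>, where they carry no meaning, the value is set by hand.\<close>
        let ?d = "\<lambda>K. if K = {} then 0 else norm (x (Sup K) - x (Inf K))"
        have "norm (sum ?t q) \<le> (\<Sum>(s,K)\<in>q. norm (x (Sup K) - x (Inf K)))"
          by (rule sum_norm_le) (auto simp: q_def norm_minus_commute)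
        also have "\<dots> = (\<Sum>(s,K)\<in>q. ?d K)"
          using nonempty by (intro sum.cong) auto
        also have "\<dots> = (\<Sum>K\<in>snd ` q. ?d K)"
          by (rule sum.over_tagged_division_lemma[OF tagged_partial_division_of_Union_self[OF q]])
            (auto simp: box_eq_empty)
        also have "\<dots> = (\<Sum>K\<in>snd ` q. norm (x (Sup K) - x (Inf K)))"
          using nonempty by (intro sum.cong) auto
        also have "\<dots> < e/2"
        proof (rule \<delta>)
          show div: "snd ` q division_of \<Union> (snd ` q)"
            by (rule partial_division_of_tagged_division[OF q])
          show "\<Union> (snd ` q) \<subseteq> {a..b}" using q by (fastforce simp: tagged_partial_division_of_def)
          have "\<Union> (snd ` q) \<subseteq> W"
            using p by (fastforce simp: q_def fine_def \<gamma>_def)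
          then show "(\<Sum>K\<in>snd ` q. measure lborel K) < \<delta>"
            using sum_content_division_le[OF div _ W(3)] W(4) by simp
        qed
        finally show ?thesis .
      qed
      show "norm ((\<Sum>(s, K)\<in>p. measure lborel K *\<^sub>R ?g s) - (x b - x a)) < e"
        unfolding eq using 1 2 norm_triangle_ineq[of "sum ?t (p - q)" "sum ?t q"] by simp
    qed
  qed
  then show "(?g has_integral (x b - x a)) {a..b}" by simp
qed

section \<open>Gronwall inequalities\<close>

text \<open>With \<open>N\<close> the right-hand side of the integral inequality,
  \<open>N r * exp (- L * (r - a))\<close> starts at \<alpha> and does not increase: its derivative
  is \<open>L * (n r - N r)\<close> times the exponential.\<close>

lemma integral_gronwall:
  fixes n :: "real \<Rightarrow> real"
  assumes cont: "continuous_on {a..b} n" and "0 \<le> L"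
    and le: "\<And>s. s \<in> {a..b} \<Longrightarrow> n s \<le> \<alpha> + L * integral {a..s} n"
    and s: "s \<in> {a..b}"
  shows "n s \<le> \<alpha> * exp (L * (s - a))"
proof -
  define N where "N = (\<lambda>r. \<alpha> + L * integral {a..r} n)"
  \<comment> \<open>The minus sign fits the monotonicity criterion, which is stated for nonnegative
    derivatives.\<close>
  define G where "G = (\<lambda>r. - (N r * exp (- L * (r - a))))"
  have derN: "(N has_real_derivative L * n r) (at r within {a..b})" if "r \<in> {a..b}" for r
    unfolding N_def
    by (rule derivative_eq_intros integral_has_real_derivative[OF cont that] refl)+ simp
  have derG: "(G has_real_derivative (L * (N r - n r)) * exp (- L * (r - a))) (at r within {a..b})"
    if "r \<in> {a..b}" for r
    unfolding G_def by (rule derivative_eq_intros derN[OF that] refl)+ (simp add: algebra_simps)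
  have "G a \<le> G s"
  proof (rule DERIV_nonneg_imp_increasing_open[where f = G and a = a and b = s])
    show "a \<le> s" using s by simp
    show "continuous_on {a..s} G"
      by (rule DERIV_continuous_on[OF DERIV_subset[OF derG]]) (use s in auto)
    fix r assume r: "a < r" "r < s"
    then have rb: "r \<in> {a..b}" "r \<in> {a<..<b}" using s by auto
    have "(G has_real_derivative (L * (N r - n r)) * exp (- L * (r - a))) (at r within {a<..<b})"
      by (rule DERIV_subset[OF derG[OF rb(1)]]) auto
    then have "(G has_real_derivative (L * (N r - n r)) * exp (- L * (r - a))) (at r)"
      using at_within_open[OF rb(2)] by simp
    moreover have "(L * (N r - n r)) * exp (- L * (r - a)) \<ge> 0"
      using le[OF rb(1)] \<open>0 \<le> L\<close> by (simp add: N_def)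
    ultimately show "\<exists>y. DERIV G r :> y \<and> y \<ge> 0" by blast
  qed
  have "G a = - \<alpha>" by (simp add: G_def N_def)
  with \<open>G a \<le> G s\<close> have "N s * exp (- L * (s - a)) \<le> \<alpha>" by (simp add: G_def)
  then have "N s * exp (- L * (s - a)) * exp (L * (s - a)) \<le> \<alpha> * exp (L * (s - a))"
    by (rule mult_right_mono) simp
  then have "N s \<le> \<alpha> * exp (L * (s - a))" by (simp add: mult.assoc flip: exp_add)
  then show ?thesis using le[OF s] by (simp add: N_def)
qed

lemma AE_lebesgue_on_subinterval:
  fixes a b c d :: real
  assumes "AE s in lebesgue_on {a..b}. P s" "a \<le> c" "d \<le> b"
  shows "AE s in lebesgue_on {c..d}. P s"
proof -
  have "AE s in lebesgue. s \<in> {a..b} \<longrightarrow> P s"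
    using assms by (simp add: AE_restrict_space_iff)
  then have "AE s in lebesgue. s \<in> {c..d} \<longrightarrow> P s"
    by eventually_elim (use assms in auto)
  then show ?thesis by (simp add: AE_restrict_space_iff)
qed

text \<open>Integrating the derivative turns the almost everywhere inequality into an integral one.
  The forcing term contributes at most \<open>\<omega> * (b - a)\<close> on every initial part, and
  this constant joins the initial value.\<close>

lemma abs_continuous_on_gronwall:
  fixes e :: "real \<Rightarrow> 'a::banach"
  assumes ac: "abs_continuous_on a b e" and "0 \<le> L" "0 \<le> \<omega>"
    and der: "AE s in lebesgue_on {a..b}. \<exists>D. (e has_vector_derivative D) (at s within {a..b}) \<and>
        norm D \<le> L * norm (e s) + \<omega>"
    and s: "s \<in> {a..b}"
  shows "norm (e s) \<le> (norm (e a) + \<omega> * (b - a)) * exp (L * (b - a))"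
proof -
  obtain N where N: "negligible N" and "\<And>s. s \<in> {a..b} - N \<Longrightarrow>
      \<exists>D. (e has_vector_derivative D) (at s within {a..b}) \<and> norm D \<le> L * norm (e s) + \<omega>"
    using AE_lebesgue_on_negligible[OF der] by auto
  then obtain g where g: "\<And>s. s \<in> {a..b} - N \<Longrightarrow>
      (e has_vector_derivative g s) (at s within {a..b}) \<and> norm (g s) \<le> L * norm (e s) + \<omega>"
    by metis
  \<comment> \<open>With the value 0 on \<open>N\<close> the norm bound holds at every point, while
    the integral is unchanged.\<close>
  define g' where "g' = (\<lambda>s. if s \<in> N then 0 else g s)"
  have cont: "continuous_on {a..b} (\<lambda>s. norm (e s))"
    by (intro continuous_intros abs_continuous_on_imp_continuous_on ac)
  have le: "norm (e r) \<le> (norm (e a) + \<omega> * (b - a)) + L * integral {a..r} (\<lambda>s. norm (e s))"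
    if r: "r \<in> {a..b}" for r
  proof -
    have sub: "{a..r} \<subseteq> {a..b}" using r by auto
    have int: "(g' has_integral e r - e a) {a..r}"
    proof (rule abs_continuous_on_has_integral[OF _ _ N])
      show "abs_continuous_on a r e" using abs_continuous_on_subinterval[OF ac] r by auto
      show "(e has_vector_derivative g' s) (at s within {a..r})" if "s \<in> {a..r} - N" for s
        using g[of s] that sub has_vector_derivative_within_subset[of e "g s" s "{a..b}" "{a..r}"]
        by (auto simp: g'_def)
    qed (use r in auto)
    have i2: "(\<lambda>s. L * norm (e s) + \<omega>) integrable_on {a..r}"
      by (intro integrable_continuous_real continuous_intros continuous_on_subset[OF cont sub])
    have i3: "(\<lambda>s. L * norm (e s)) integrable_on {a..r}"
      by (intro integrable_continuous_real continuous_intros continuous_on_subset[OF cont sub])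
    have "norm (e r - e a) = norm (integral {a..r} g')"
      using int by (simp add: integral_unique)
    also have "\<dots> \<le> integral {a..r} (\<lambda>s. L * norm (e s) + \<omega>)"
    proof (rule Henstock_Kurzweil_Integration.integral_norm_bound_integral[OF _ i2])
      show "g' integrable_on {a..r}" using int by blast
      show "norm (g' s) \<le> L * norm (e s) + \<omega>" if "s \<in> {a..r}" for s
        using g[of s] that sub \<open>0 \<le> L\<close> \<open>0 \<le> \<omega>\<close> by (auto simp: g'_def)
    qed
    also have "\<dots> = L * integral {a..r} (\<lambda>s. norm (e s)) + \<omega> * (r - a)"
      using r i3 by (subst Henstock_Kurzweil_Integration.integral_add) auto
    also have "\<dots> \<le> L * integral {a..r} (\<lambda>s. norm (e s)) + \<omega> * (b - a)"
      using r \<open>0 \<le> \<omega>\<close> by (auto intro: mult_left_mono)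
    finally show ?thesis using norm_triangle_sub[of "e r" "e a"] by simp
  qed
  have "norm (e s) \<le> (norm (e a) + \<omega> * (b - a)) * exp (L * (s - a))"
    using integral_gronwall[OF cont \<open>0 \<le> L\<close> le s] .
  also have "\<dots> \<le> (norm (e a) + \<omega> * (b - a)) * exp (L * (b - a))"
    using s \<open>0 \<le> L\<close> \<open>0 \<le> \<omega>\<close> by (intro mult_left_mono) (auto intro!: mult_left_mono)
  finally show ?thesis .
qed

text \<open>Continuity argument: at the first time the norm reaches \<open>\<rho>\<close> the Gronwall bound, valid up to
  that time, is already violated.\<close>

lemma abs_continuous_on_gronwall_bootstrap:
  fixes e :: "real \<Rightarrow> 'a::banach"
  assumes ac: "abs_continuous_on a b e" and "0 \<le> L" "0 \<le> \<omega>"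
    and der: "AE s in lebesgue_on {a..b}. norm (e s) \<le> \<rho> \<longrightarrow>
        (\<exists>D. (e has_vector_derivative D) (at s within {a..b}) \<and> norm D \<le> L * norm (e s) + \<omega>)"
    and small: "(norm (e a) + \<omega> * (b - a)) * exp (L * (b - a)) < \<rho>"
    and s: "s \<in> {a..b}"
  shows "norm (e s) \<le> (norm (e a) + \<omega> * (b - a)) * exp (L * (b - a))"
proof -
  have cont: "continuous_on {a..b} (\<lambda>s. norm (e s))"
    by (intro continuous_intros abs_continuous_on_imp_continuous_on ac)
  have upto: "norm (e c) \<le> (norm (e a) + \<omega> * (b - a)) * exp (L * (b - a))"
    if c: "c \<in> {a..b}" and below: "\<And>r. r \<in> {a..<c} \<Longrightarrow> norm (e r) \<le> \<rho>" for c
  proof -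
    have sub: "{a..c} \<subseteq> {a..b}" using c by auto
    \<comment> \<open>The differential inequality is conditional on the norm being at most \<rho>,
      which is not known at \<open>c\<close>; one point is a null set.\<close>
    have "AE s in lebesgue. s \<noteq> c"
      by (rule AE_I[of _ _ "{c}"]) auto
    then have "AE s in lebesgue_on {a..c}. s \<noteq> c"
      by (subst AE_restrict_space_iff) (auto elim: eventually_mono)
    moreover have "AE s in lebesgue_on {a..c}. norm (e s) \<le> \<rho> \<longrightarrow>
        (\<exists>D. (e has_vector_derivative D) (at s within {a..b}) \<and> norm D \<le> L * norm (e s) + \<omega>)"
      by (rule AE_lebesgue_on_subinterval[OF der]) (use c in auto)
    ultimately have "AE s in lebesgue_on {a..c}.
        \<exists>D. (e has_vector_derivative D) (at s within {a..c}) \<and> norm D \<le> L * norm (e s) + \<omega>"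
      using AE_space
    proof eventually_elim
      case (elim s)
      then have "s \<in> {a..<c}" by auto
      with elim below[of s] obtain D where
        "(e has_vector_derivative D) (at s within {a..b})" "norm D \<le> L * norm (e s) + \<omega>"
        by auto
      then show ?case using has_vector_derivative_within_subset[OF _ sub] by blast
    qed
    moreover have "abs_continuous_on a c e" using abs_continuous_on_subinterval[OF ac] c by auto
    ultimately have "norm (e c) \<le> (norm (e a) + \<omega> * (c - a)) * exp (L * (c - a))"
      using c \<open>0 \<le> L\<close> \<open>0 \<le> \<omega>\<close> by (intro abs_continuous_on_gronwall) auto
    also have "\<dots> \<le> (norm (e a) + \<omega> * (b - a)) * exp (L * (b - a))"
      using c \<open>0 \<le> L\<close> \<open>0 \<le> \<omega>\<close> by (intro mult_mono add_left_mono) (auto intro!: mult_left_mono)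
    finally show ?thesis .
  qed
  have below: "norm (e r) < \<rho>" if "r \<in> {a..b}" for r
  proof (rule ccontr)
    assume "\<not> norm (e r) < \<rho>"
    define A where "A = {s \<in> {a..b}. \<rho> \<le> norm (e s)}"
    have "A = {a..b} \<inter> (\<lambda>s. norm (e s)) -` {\<rho>..}" by (auto simp: A_def)
    then have "closed A" using continuous_closed_preimage[OF cont, of "{\<rho>..}"] by simp
    moreover have "A \<noteq> {}" "bdd_below A" using \<open>\<not> norm (e r) < \<rho>\<close> that
      by (auto simp: A_def intro: bdd_belowI[of _ a])
    ultimately have c: "Inf A \<in> A" by (simp add: closed_contains_Inf)
    have "norm (e s) \<le> \<rho>" if "s \<in> {a..<Inf A}" for s
      using cInf_lower[OF _ \<open>bdd_below A\<close>, of s] that c by (force simp: A_def)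
    then have "norm (e (Inf A)) < \<rho>"
      using upto[of "Inf A"] small c by (auto simp: A_def)
    then show False using c by (auto simp: A_def)
  qed
  show ?thesis
  proof (rule upto[OF s])
    show "norm (e r) \<le> \<rho>" if "r \<in> {a..<s}" for r using below[of r] that s by force
  qed
qed

section \<open>Quantitative bounds for twice continuously differentiable maps\<close>

text \<open>Compactness of the ball bounds both derivatives, and its convexity lets the mean value
  inequality use these bounds: \<open>L\<close> bounds the first derivative, \<open>B\<close> the
  second. The last estimate measures the failure of \<open>g\<close> to be affine along a segment,
  in a form that refers to values of \<open>g\<close> alone.\<close>

lemma C2_cball_bounds:
  fixes g :: "'a::euclidean_space \<Rightarrow> 'b::real_normed_vector"
  assumes "C2 g"
  obtains L B where "0 \<le> L" "0 \<le> B"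
    "\<And>x y. x \<in> cball 0 M \<Longrightarrow> y \<in> cball 0 M \<Longrightarrow> norm (g x - g y) \<le> L * norm (x - y)"
    "\<And>x y l. x \<in> cball 0 M \<Longrightarrow> y \<in> cball 0 M \<Longrightarrow> 0 \<le> l \<Longrightarrow> l \<le> 1 \<Longrightarrow>
       norm (g ((1 - l) *\<^sub>R x + l *\<^sub>R y) - ((1 - l) *\<^sub>R g x + l *\<^sub>R g y))
         \<le> B * (l * (1 - l)) * (norm (x - y))\<^sup>2"
proof -
  obtain g' :: "'a \<Rightarrow> 'a \<Rightarrow>\<^sub>L 'b" and g'' :: "'a \<Rightarrow> 'a \<Rightarrow>\<^sub>L 'a \<Rightarrow>\<^sub>L 'b" where
    g': "\<And>z. (g has_derivative blinfun_apply (g' z)) (at z)" and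
    g'': "\<And>z. (g' has_derivative blinfun_apply (g'' z)) (at z)" and
    cont: "continuous_on UNIV g''"
    using assms unfolding C2_def by blast
  let ?S = "cball (0::'a) M"
  have bounded: "\<exists>B\<ge>0. \<forall>z\<in>?S. norm (k z) \<le> B" if "continuous_on ?S k"
    for k :: "'a \<Rightarrow> 'c::real_normed_vector"
  proof -
    have "bounded (k ` ?S)" by (intro compact_imp_bounded compact_continuous_image that compact_cball)
    then show ?thesis unfolding bounded_pos by (meson imageI less_imp_le)
  qed
  obtain B where B: "0 \<le> B" "\<And>z. z \<in> ?S \<Longrightarrow> norm (g'' z) \<le> B"
    using bounded[OF continuous_on_subset[OF cont subset_UNIV]] by blast
  have "continuous_on ?S g'"
    by (meson g'' continuous_at_imp_continuous_on has_derivative_continuous)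
  then obtain L where L: "0 \<le> L" "\<And>z. z \<in> ?S \<Longrightarrow> norm (g' z) \<le> L"
    using bounded by blast
  have lip: "norm (g x - g y) \<le> L * norm (x - y)" if "x \<in> ?S" "y \<in> ?S" for x y
    by (rule differentiable_bound[of ?S g "\<lambda>z. blinfun_apply (g' z)"])
      (use that L g' in \<open>auto simp: has_derivative_at_withinI norm_blinfun.rep_eq[symmetric]\<close>)
  have lip': "norm (g' x - g' y) \<le> B * norm (x - y)" if "x \<in> ?S" "y \<in> ?S" for x y
    by (rule differentiable_bound[of ?S g' "\<lambda>z. blinfun_apply (g'' z)"])
      (use that B g'' in \<open>auto simp: has_derivative_at_withinI norm_blinfun.rep_eq[symmetric]\<close>)
  \<comment> \<open>The Lipschitz bound for \<open>g'\<close> along the segment gives the constant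
    \<open>B\<close>; the sharper factor 1/2 of Taylor's formula is given up.\<close>
  have taylor: "norm (g q - g p - g' p (q - p)) \<le> B * (norm (q - p))\<^sup>2" if "p \<in> ?S" "q \<in> ?S" for p q
  proof -
    have seg: "closed_segment p q \<subseteq> ?S" using that by (intro closed_segment_subset) auto
    have "norm (g q - g p - g' p (q - p)) \<le> norm (q - p) * (B * norm (q - p))"
    proof (rule differentiable_bound_linearization[of p q "closed_segment p q" g "\<lambda>z. blinfun_apply (g' z)"])
      show "p + t *\<^sub>R (q - p) \<in> closed_segment p q" if "t \<in> {0..1}" for t
        using that by (auto simp: in_segment algebra_simps intro!: exI[of _ t])
      show "(g has_derivative g' z) (at z within closed_segment p q)" for z
        by (rule has_derivative_at_withinI[OF g'])
      fix z assume z: "z \<in> closed_segment p q"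
      have "onorm (blinfun_apply (g' z) - blinfun_apply (g' p)) = norm (g' z - g' p)"
        by (simp add: norm_blinfun.rep_eq minus_blinfun.rep_eq fun_diff_def)
      also have "\<dots> \<le> B * norm (z - p)" using lip' z seg that by auto
      also have "\<dots> \<le> B * norm (q - p)"
        using segment_bound(1)[OF z] B(1) by (intro mult_left_mono) auto
      finally show "onorm (blinfun_apply (g' z) - blinfun_apply (g' p)) \<le> B * norm (q - p)" .
    qed auto
    then show ?thesis by (simp add: power2_eq_square mult_ac)
  qed
  have aff: "norm (g ((1 - l) *\<^sub>R x + l *\<^sub>R y) - ((1 - l) *\<^sub>R g x + l *\<^sub>R g y))
         \<le> B * (l * (1 - l)) * (norm (x - y))\<^sup>2"
    if xy: "x \<in> ?S" "y \<in> ?S" and l: "0 \<le> l" "l \<le> 1" for x y l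
  proof -
    define z where "z = (1 - l) *\<^sub>R x + l *\<^sub>R y"
    have z: "z \<in> ?S" using convexD_alt[OF convex_cball xy l] by (simp add: z_def)
    let ?r = "\<lambda>w. g w - g z - g' z (w - z)"
    have xz: "x - z = l *\<^sub>R (x - y)" and yz: "y - z = (l - 1) *\<^sub>R (x - y)"
      by (simp_all add: z_def algebra_simps)
    \<comment> \<open>Both expansions are made at \<open>z\<close>, whose weighted displacements to
      \<open>x\<close> and \<open>y\<close> sum to zero, so the first-order terms cancel.\<close>
    have "(1 - l) *\<^sub>R g x + l *\<^sub>R g y - g z = (1 - l) *\<^sub>R ?r x + l *\<^sub>R ?r y"
      unfolding xz yz blinfun.scaleR_right
      by (simp add: scaleR_diff_right scaleR_diff_left scaleR_add_right left_diff_distrib)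
    then have "norm (g z - ((1 - l) *\<^sub>R g x + l *\<^sub>R g y)) = norm ((1 - l) *\<^sub>R ?r x + l *\<^sub>R ?r y)"
      by (metis norm_minus_commute)
    also have "\<dots> \<le> (1 - l) * norm (?r x) + l * norm (?r y)"
      using norm_triangle_ineq[of "(1 - l) *\<^sub>R ?r x" "l *\<^sub>R ?r y"] l by simp
    also have "\<dots> \<le> (1 - l) * (B * (norm (x - z))\<^sup>2) + l * (B * (norm (y - z))\<^sup>2)"
      using l xy z by (intro add_mono mult_left_mono taylor) auto
    \<comment> \<open>The weight comes from (1 - l) l^2 + l (1 - l)^2 = l (1 - l).\<close>
    also have "\<dots> = B * (l * (1 - l)) * (norm (x - y))\<^sup>2"
      unfolding xz yz by (simp add: power_mult_distrib power2_abs) algebra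
    finally show ?thesis by (simp add: z_def)
  qed
  show ?thesis using that L(1) B(1) lip aff by blast
qed

text \<open>The source of strong convexity; for \<open>l = 1/2\<close> it is the parallelogram
  law.\<close>

lemma norm_convex_combination_sq:
  fixes p q :: "'a::real_inner"
  shows "(norm ((1 - l) *\<^sub>R p + l *\<^sub>R q))\<^sup>2
       = (1 - l) * (norm p)\<^sup>2 + l * (norm q)\<^sup>2 - l * (1 - l) * (norm (p - q))\<^sup>2"
  by (simp add: power2_norm_eq_inner inner_simps inner_commute) algebra

text \<open>For an exact convex combination \<open>z\<close> this follows from the preceding
  identity. The deviation of \<open>z\<close> enters through a cross term, where the residual bound
  \<rho> appears as a factor, and through its own square, which is of fourth order in
  \<open>D\<close>. Small \<rho> and \<open>D\<close> therefore make the loss small against the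
  gain.\<close>

lemma strong_convexity_pointwise:
  fixes y p q z :: "'a::real_inner"
  assumes l: "0 \<le> l" "l \<le> 1" and "0 \<le> C"
    and \<rho>: "norm (y - p) \<le> \<rho>" "norm (y - q) \<le> \<rho>"
    and z: "norm (z - ((1 - l) *\<^sub>R p + l *\<^sub>R q)) \<le> C * (l * (1 - l)) * D\<^sup>2"
  shows "(norm (y - z))\<^sup>2 \<le> (1 - l) * (norm (y - p))\<^sup>2 + l * (norm (y - q))\<^sup>2
      - l * (1 - l) * (norm (p - q))\<^sup>2 + l * (1 - l) * D\<^sup>2 * (2 * \<rho> * C + C\<^sup>2 * D\<^sup>2)"
proof -
  let ?v = "(1 - l) *\<^sub>R (y - p) + l *\<^sub>R (y - q)" and ?e = "z - ((1 - l) *\<^sub>R p + l *\<^sub>R q)"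
  have "0 \<le> l * (1 - l)" "l * (1 - l) \<le> 1" using l by (auto intro: mult_le_one)
  have "norm ?v \<le> (1 - l) * norm (y - p) + l * norm (y - q)"
    using norm_triangle_ineq[of "(1 - l) *\<^sub>R (y - p)" "l *\<^sub>R (y - q)"] l by simp
  also have "\<dots> \<le> (1 - l) * \<rho> + l * \<rho>" using l \<rho> by (intro add_mono mult_left_mono) auto
  finally have v: "norm ?v \<le> \<rho>" by (simp add: algebra_simps)
  have "y - z = ?v - ?e" by (simp add: algebra_simps)
  then have "norm (y - z) \<le> norm ?v + norm ?e"
    by (metis norm_triangle_ineq4)
  then have "(norm (y - z))\<^sup>2 \<le> (norm ?v + norm ?e)\<^sup>2"
    by (simp add: power_mono)
  also have "\<dots> = (norm ?v)\<^sup>2 + 2 * (norm ?v * norm ?e) + norm ?e * norm ?e"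
    by (simp add: power2_eq_square algebra_simps)
  \<comment> \<open>In the square of the deviation one factor \<open>l * (1 - l)\<close> is kept and
    the other is bounded by 1, so that every error term carries the weight exactly once.\<close>
  also have "\<dots> \<le> (norm ?v)\<^sup>2 + 2 * (\<rho> * (C * (l * (1 - l)) * D\<^sup>2))
      + (C * (l * (1 - l)) * D\<^sup>2) * (C * 1 * D\<^sup>2)"
    using v z order_trans[OF norm_ge_zero v] \<open>0 \<le> C\<close> \<open>0 \<le> l * (1 - l)\<close> \<open>l * (1 - l) \<le> 1\<close>
    by (intro add_mono mult_mono mult_left_mono order_refl order_trans[OF z]) auto
  also have "\<dots> = (norm ?v)\<^sup>2 + l * (1 - l) * D\<^sup>2 * (2 * \<rho> * C + C\<^sup>2 * D\<^sup>2)"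
    by algebra
  finally show ?thesis
    unfolding norm_convex_combination_sq by (simp add: norm_minus_commute)
qed

section \<open>Least squares with a coercive, nearly affine model\<close>

text \<open>A local solution competes with a full neighbourhood in the space, so the minimizer over
  the closed ball qualifies only because \<open>interior\<close> and \<open>r < R\<close> keep it
  off the boundary. Uniqueness also excludes boundary points: the segment towards the minimizer
  stays in the ball, and strict convexity decreases \<open>F\<close> along it.\<close>

lemma strictly_convex_unique_local_solution:
  fixes F :: "'a::euclidean_space \<Rightarrow> real"
  assumes "0 < R" and cont: "continuous_on (cball x R) F"
    and conv: "\<And>\<xi> \<zeta> l. \<xi> \<in> cball x R \<Longrightarrow> \<zeta> \<in> cball x R \<Longrightarrow> \<xi> \<noteq> \<zeta> \<Longrightarrow> 0 < l \<Longrightarrow> l < 1 \<Longrightarrow>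
        F ((1 - l) *\<^sub>R \<xi> + l *\<^sub>R \<zeta>) < (1 - l) * F \<xi> + l * F \<zeta>"
    and interior: "\<And>\<xi>. \<xi> \<in> cball x R \<Longrightarrow> F \<xi> \<le> F x \<Longrightarrow> dist x \<xi> \<le> r" and "r < R"
  shows "\<exists>!\<xi>. \<xi> \<in> cball x R \<and> local_solution F \<xi>"
    and "\<And>\<xi>. \<xi> \<in> cball x R \<Longrightarrow> local_solution F \<xi> \<Longrightarrow> dist x \<xi> \<le> r"
proof -
  obtain m where m: "m \<in> cball x R" "\<And>\<zeta>. \<zeta> \<in> cball x R \<Longrightarrow> F m \<le> F \<zeta>"
    using continuous_attains_inf[OF compact_cball _ cont] \<open>0 < R\<close> by fastforce
  have mr: "dist x m \<le> r" using m \<open>0 < R\<close> by (intro interior) auto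
  have loc: "local_solution F m"
    unfolding local_solution_def
    using m(2) mr \<open>r < R\<close> by (intro exI[of _ "ball x R"]) (auto simp: less_imp_le)
  have uniq: "\<xi> = m" if \<xi>: "\<xi> \<in> cball x R" and sol: "local_solution F \<xi>" for \<xi>
  proof (rule ccontr)
    assume "\<xi> \<noteq> m"
    obtain N where N: "open N" "\<xi> \<in> N" "\<And>\<zeta>. \<zeta> \<in> N \<Longrightarrow> F \<xi> \<le> F \<zeta>"
      using sol unfolding local_solution_def by blast
    have "((\<lambda>l. (1 - l) *\<^sub>R \<xi> + l *\<^sub>R m) \<longlongrightarrow> (1 - 0) *\<^sub>R \<xi> + 0 *\<^sub>R m) (at_right (0::real))"
      by (intro tendsto_intros)
    \<comment> \<open>A short enough step from \<xi> towards \<open>m\<close> remains in the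
      neighbourhood where \<xi> is optimal.\<close>
    then have "eventually (\<lambda>l. (1 - l) *\<^sub>R \<xi> + l *\<^sub>R m \<in> N) (at_right (0::real))"
      using topological_tendstoD[OF _ N(1)] N(2) by fastforce
    moreover have "eventually (\<lambda>l::real. 0 < l \<and> l < 1) (at_right 0)"
      by (auto simp: eventually_at_right_field intro: exI[of _ 1])
    ultimately have "eventually (\<lambda>l. 0 < l \<and> l < 1 \<and> (1 - l) *\<^sub>R \<xi> + l *\<^sub>R m \<in> N) (at_right (0::real))"
      by eventually_elim auto
    then obtain l :: real where l: "0 < l" "l < 1" "(1 - l) *\<^sub>R \<xi> + l *\<^sub>R m \<in> N"
      using eventually_happens'[of "at_right (0::real)"] by auto
    have "F \<xi> \<le> F ((1 - l) *\<^sub>R \<xi> + l *\<^sub>R m)" using N l by blast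
    also have "\<dots> < (1 - l) * F \<xi> + l * F m" by (rule conv) (use l \<xi> m \<open>\<xi> \<noteq> m\<close> in auto)
    also have "\<dots> \<le> (1 - l) * F \<xi> + l * F \<xi>" using m(2)[OF \<xi>] l by auto
    finally show False by (simp add: algebra_simps)
  qed
  show "\<exists>!\<xi>. \<xi> \<in> cball x R \<and> local_solution F \<xi>" using m(1) loc uniq by blast
  show "\<And>\<xi>. \<xi> \<in> cball x R \<Longrightarrow> local_solution F \<xi> \<Longrightarrow> dist x \<xi> \<le> r" using uniq mr by blast
qed

text \<open>The dynamics enter only through bounds on the model \<open>H\<close>. The constants
  \<open>\<nu>\<close>, \<open>R\<close>, \<open>K\<close> are produced before the data
  \<open>Y\<close>, hence are uniform over all admissible noise; \<delta> bounds the residual at the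
  reference point \<open>x\<close>.\<close>

theorem least_squares_local_solution:
  fixes H :: "'a::euclidean_space \<Rightarrow> 's \<Rightarrow> 'b::euclidean_space" and x :: 'a and C c R\<^sub>0 :: real
  assumes "finite_measure M" and "0 \<le> C" "0 < c" "0 < R\<^sub>0"
    and meas: "\<And>\<xi>. \<xi> \<in> cball x R\<^sub>0 \<Longrightarrow> H \<xi> \<in> borel_measurable M"
    and lip: "\<And>\<xi> \<zeta> s. \<xi> \<in> cball x R\<^sub>0 \<Longrightarrow> \<zeta> \<in> cball x R\<^sub>0 \<Longrightarrow> s \<in> space M \<Longrightarrow>
        norm (H \<xi> s - H \<zeta> s) \<le> C * norm (\<xi> - \<zeta>)"
    and aff: "\<And>\<xi> \<zeta> l s. \<xi> \<in> cball x R\<^sub>0 \<Longrightarrow> \<zeta> \<in> cball x R\<^sub>0 \<Longrightarrow> 0 \<le> l \<Longrightarrow> l \<le> 1 \<Longrightarrow> s \<in> space M \<Longrightarrow>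
        norm (H ((1 - l) *\<^sub>R \<xi> + l *\<^sub>R \<zeta>) s - ((1 - l) *\<^sub>R H \<xi> s + l *\<^sub>R H \<zeta> s))
          \<le> C * (l * (1 - l)) * (norm (\<xi> - \<zeta>))\<^sup>2"
    and coercive: "\<And>\<xi> \<zeta>. \<xi> \<in> cball x R\<^sub>0 \<Longrightarrow> \<zeta> \<in> cball x R\<^sub>0 \<Longrightarrow>
        c * (norm (\<xi> - \<zeta>))\<^sup>2 \<le> (\<integral>s. (norm (H \<xi> s - H \<zeta> s))\<^sup>2 \<partial>M)"
  obtains \<nu> R K where "0 < \<nu>" "0 < R" "0 < K"
    "\<And>Y \<delta>. Y \<in> borel_measurable M \<Longrightarrow> 0 \<le> \<delta> \<Longrightarrow> \<delta> < \<nu> \<Longrightarrow> AE s in M. norm (Y s - H x s) \<le> \<delta> \<Longrightarrow>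
       (\<exists>!\<xi>. \<xi> \<in> cball x R \<and> local_solution (\<lambda>\<zeta>. \<integral>s. (norm (Y s - H \<zeta> s))\<^sup>2 \<partial>M) \<xi>) \<and>
       (\<forall>\<xi>. \<xi> \<in> cball x R \<and> local_solution (\<lambda>\<zeta>. \<integral>s. (norm (Y s - H \<zeta> s))\<^sup>2 \<partial>M) \<xi> \<longrightarrow>
          norm (\<xi> - x) \<le> K * \<delta>)"
proof -
  interpret finite_measure M by fact
  define m where "m = measure M (space M)"
  have "0 \<le> m" by (simp add: m_def)
  \<comment> \<open>\<open>R * q\<close> will dominate the integrated error factor
    \<open>m * Q\<close>: it results from \<open>2 * \<rho> * C + C\<^sup>2 * D\<^sup>2\<close> by
    inserting \<open>\<rho> \<le> R * (1 + C)\<close> and \<open>D\<^sup>2 \<le> 4 * R\<close>, the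
    latter using \<open>R \<le> 1\<close>. The choice of \<open>R\<close> then limits the loss to
    half of the coercivity constant \<open>c\<close>.\<close>
  define q where "q = m * (2 * (1 + C) * C + 4 * C\<^sup>2)"
  have "0 \<le> q" using \<open>0 \<le> m\<close> \<open>0 \<le> C\<close> by (simp add: q_def)
  define R where "R = min (min R\<^sub>0 1) (c / (2 * (q + 1)))"
  have R: "0 < R" "R \<le> R\<^sub>0" "R \<le> 1" "R * q \<le> c / 2"
  proof -
    show "0 < R" "R \<le> R\<^sub>0" "R \<le> 1" using \<open>0 < R\<^sub>0\<close> \<open>0 < c\<close> \<open>0 \<le> q\<close> by (auto simp: R_def)
    have "R * (q + 1) \<le> c / (2 * (q + 1)) * (q + 1)"
      using \<open>0 \<le> q\<close> by (intro mult_right_mono) (auto simp: R_def)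
    also have "\<dots> = c / 2" using \<open>0 \<le> q\<close> by (simp add: field_simps)
    finally show "R * q \<le> c / 2" using \<open>0 < R\<close> by (simp add: algebra_simps)
  qed
  \<comment> \<open>The comparison of costs ends in c d^2 \<le> 4 m \<delta>^2 for the distance d
    from \<open>x\<close>, that is, d \<le> 2 sqrt (m / c) \<delta>. The added 1 keeps
    \<open>K\<close> positive even if \<open>m = 0\<close>.\<close>
  define K where "K = 2 * sqrt (m / c) + 1"
  have "0 < K" using \<open>0 \<le> m\<close> \<open>0 < c\<close> by (auto simp: K_def intro: add_nonneg_pos)
  \<comment> \<open>\<open>\<delta> < R\<close> keeps the residual bound proportional to
    \<open>R\<close>; \<open>K * \<delta> < R\<close> keeps the minimizer in the interior.\<close>
  define \<nu> where "\<nu> = min R (R / K)"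
  have "0 < \<nu>" using \<open>0 < K\<close> R by (simp add: \<nu>_def)
  show ?thesis
  proof (rule that[OF \<open>0 < \<nu>\<close> \<open>0 < R\<close> \<open>0 < K\<close>], goal_cases)
    case (1 Y \<delta>)
    note Y = 1(1) and \<delta> = 1(2,3) and near = 1(4)
    let ?F = "\<lambda>\<zeta>. \<integral>s. (norm (Y s - H \<zeta> s))\<^sup>2 \<partial>M"
    have "\<delta> < R" "K * \<delta> < R" using \<delta> \<open>0 < K\<close> by (auto simp: \<nu>_def field_simps)
    have sub: "\<xi> \<in> cball x R\<^sub>0" if "\<xi> \<in> cball x R" for \<xi> using that R by auto
    have xR: "x \<in> cball x R" using R by simp
    note [measurable] = Y
    have m[measurable]: "H \<xi> \<in> borel_measurable M" if "\<xi> \<in> cball x R" for \<xi>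
      using meas sub that by blast
    define \<rho> where "\<rho> = \<delta> + C * R"
    have "0 \<le> \<rho>" using \<delta> R \<open>0 \<le> C\<close> by (simp add: \<rho>_def)
    have bound: "AE s in M. norm (Y s - H \<xi> s) \<le> \<rho>" if "\<xi> \<in> cball x R" for \<xi>
      using near AE_space
    proof eventually_elim
      case (elim s)
      have "norm (Y s - H \<xi> s) \<le> norm (Y s - H x s) + norm (H x s - H \<xi> s)"
        using norm_triangle_ineq[of "Y s - H x s" "H x s - H \<xi> s"] by simp
      also have "\<dots> \<le> \<delta> + C * norm (x - \<xi>)"
        using elim by (intro add_mono lip sub xR that)
      also have "\<dots> \<le> \<rho>"
        using that \<open>0 \<le> C\<close> by (auto simp: \<rho>_def dist_norm intro: mult_left_mono)
      finally show ?case .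
    qed
    have int: "integrable M (\<lambda>s. (norm (Y s - H \<xi> s))\<^sup>2)" if "\<xi> \<in> cball x R" for \<xi>
    proof (rule integrable_const_bound[where B = "\<rho>\<^sup>2"])
      show "AE s in M. norm ((norm (Y s - H \<xi> s))\<^sup>2) \<le> \<rho>\<^sup>2"
        using bound[OF that] by eventually_elim (simp add: power_mono)
    qed (use m[OF that] in measurable)
    have intd: "integrable M (\<lambda>s. (norm (H \<xi> s - H \<zeta> s))\<^sup>2)"
      if "\<xi> \<in> cball x R" "\<zeta> \<in> cball x R" for \<xi> \<zeta>
    proof (rule integrable_const_bound[where B = "(C * norm (\<xi> - \<zeta>))\<^sup>2"])
      show "AE s in M. norm ((norm (H \<xi> s - H \<zeta> s))\<^sup>2) \<le> (C * norm (\<xi> - \<zeta>))\<^sup>2"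
        using lip[OF sub[OF that(1)] sub[OF that(2)]] by (intro AE_I2) (simp add: power_mono)
    qed (use m[OF that(1)] m[OF that(2)] in measurable)
    have conv: "?F ((1 - l) *\<^sub>R \<xi> + l *\<^sub>R \<zeta>) < (1 - l) * ?F \<xi> + l * ?F \<zeta>"
      if \<xi>: "\<xi> \<in> cball x R" and \<zeta>: "\<zeta> \<in> cball x R" and "\<xi> \<noteq> \<zeta>" and l: "0 < l" "l < 1" for \<xi> \<zeta> l
    proof -
      let ?z = "(1 - l) *\<^sub>R \<xi> + l *\<^sub>R \<zeta>" and ?D = "norm (\<xi> - \<zeta>)"
      have z: "?z \<in> cball x R" using convexD_alt[OF convex_cball \<xi> \<zeta>, of l] l by simp
      have ll: "0 < l * (1 - l)" using l by simp
      have "?D > 0" using \<open>\<xi> \<noteq> \<zeta>\<close> by simp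
      have D: "?D \<le> 2 * R"
        using \<xi> \<zeta> dist_triangle2[of \<xi> \<zeta> x] by (simp add: dist_commute flip: dist_norm)
      define Q where "Q = 2 * \<rho> * C + C\<^sup>2 * ?D\<^sup>2"
      have "Q \<le> R * (2 * (1 + C) * C + 4 * C\<^sup>2)"
      proof -
        have "\<rho> \<le> R * (1 + C)" using \<open>\<delta> < R\<close> by (simp add: \<rho>_def algebra_simps)
        moreover have "?D\<^sup>2 \<le> 4 * R"
        proof -
          have "?D\<^sup>2 \<le> (2 * R)\<^sup>2" using D by (intro power_mono) auto
          also have "\<dots> = 4 * R * R" by (simp add: power2_eq_square)
          also have "\<dots> \<le> 4 * R * 1" using R by (intro mult_left_mono) auto
          finally show ?thesis by simp
        qed
        ultimately have "2 * \<rho> * C + C\<^sup>2 * ?D\<^sup>2 \<le> 2 * (R * (1 + C)) * C + C\<^sup>2 * (4 * R)"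
          using \<open>0 \<le> C\<close> by (intro add_mono mult_mono mult_left_mono) (auto simp: R less_imp_le)
        then show ?thesis by (simp add: Q_def algebra_simps)
      qed
      then have "m * Q \<le> R * q"
        using mult_left_mono[OF _ \<open>0 \<le> m\<close>] by (fastforce simp: q_def mult_ac)
      then have Q: "m * Q \<le> c / 2" using R by simp
      have "?F ?z \<le> (\<integral>s. (1 - l) * (norm (Y s - H \<xi> s))\<^sup>2 + l * (norm (Y s - H \<zeta> s))\<^sup>2
          - l * (1 - l) * (norm (H \<xi> s - H \<zeta> s))\<^sup>2 + l * (1 - l) * ?D\<^sup>2 * Q \<partial>M)"
      proof (rule integral_mono_AE[OF int[OF z]])
        show "AE s in M. (norm (Y s - H ?z s))\<^sup>2 \<le> (1 - l) * (norm (Y s - H \<xi> s))\<^sup>2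
            + l * (norm (Y s - H \<zeta> s))\<^sup>2 - l * (1 - l) * (norm (H \<xi> s - H \<zeta> s))\<^sup>2
            + l * (1 - l) * ?D\<^sup>2 * Q"
          using bound[OF \<xi>] bound[OF \<zeta>] AE_space
        proof eventually_elim
          case (elim s)
          show ?case
            unfolding Q_def
            by (rule strong_convexity_pointwise)
              (use l elim \<open>0 \<le> C\<close> aff[OF sub[OF \<xi>] sub[OF \<zeta>]] in auto)
        qed
      qed (use int intd \<xi> \<zeta> in auto)
      also have "\<dots> = (1 - l) * ?F \<xi> + l * ?F \<zeta>
          - l * (1 - l) * (\<integral>s. (norm (H \<xi> s - H \<zeta> s))\<^sup>2 \<partial>M) + l * (1 - l) * ?D\<^sup>2 * (m * Q)"
        using int intd \<xi> \<zeta> by (simp add: m_def)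
      \<comment> \<open>Coercivity yields \<open>c\<close> and the defect costs at most
        \<open>c / 2\<close>, both with weight \<open>l * (1 - l) * ?D\<^sup>2\<close>; the net gain
        is strict.\<close>
      also have "\<dots> \<le> (1 - l) * ?F \<xi> + l * ?F \<zeta> - l * (1 - l) * (c * ?D\<^sup>2) + l * (1 - l) * ?D\<^sup>2 * (c / 2)"
        using ll Q coercive[OF sub[OF \<xi>] sub[OF \<zeta>]]
        by (intro add_mono diff_mono mult_left_mono order_refl) auto
      also have "\<dots> = (1 - l) * ?F \<xi> + l * ?F \<zeta> - l * (1 - l) * (c * ?D\<^sup>2) / 2"
        by (simp add: field_simps)
      also have "\<dots> < (1 - l) * ?F \<xi> + l * ?F \<zeta>"
        using ll \<open>0 < c\<close> \<open>?D > 0\<close> by simp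
      finally show ?thesis .
    qed
    have cont: "continuous_on (cball x R) ?F"
    proof (rule lipschitz_on_continuous_on[where L = "m * (2 * \<rho> * C)"], rule lipschitz_onI)
      show "0 \<le> m * (2 * \<rho> * C)" using \<open>0 \<le> m\<close> \<open>0 \<le> \<rho>\<close> \<open>0 \<le> C\<close> by simp
      fix \<xi> \<zeta> assume \<xi>: "\<xi> \<in> cball x R" and \<zeta>: "\<zeta> \<in> cball x R"
      have "\<bar>?F \<xi> - ?F \<zeta>\<bar> = \<bar>\<integral>s. (norm (Y s - H \<xi> s))\<^sup>2 - (norm (Y s - H \<zeta> s))\<^sup>2 \<partial>M\<bar>"
        using int \<xi> \<zeta> by simp
      also have "\<dots> \<le> (\<integral>s. \<bar>(norm (Y s - H \<xi> s))\<^sup>2 - (norm (Y s - H \<zeta> s))\<^sup>2\<bar> \<partial>M)"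
        by (rule integral_abs_bound)
      also have "\<dots> \<le> (\<integral>s. 2 * \<rho> * C * norm (\<xi> - \<zeta>) \<partial>M)"
      proof (rule integral_mono_AE)
        show "AE s in M. \<bar>(norm (Y s - H \<xi> s))\<^sup>2 - (norm (Y s - H \<zeta> s))\<^sup>2\<bar> \<le> 2 * \<rho> * C * norm (\<xi> - \<zeta>)"
          using bound[OF \<xi>] bound[OF \<zeta>] AE_space
        proof eventually_elim
          case (elim s)
          let ?p = "norm (Y s - H \<xi> s)" and ?q = "norm (Y s - H \<zeta> s)"
          have "\<bar>?p - ?q\<bar> \<le> norm (H \<xi> s - H \<zeta> s)"
            using norm_triangle_ineq3[of "Y s - H \<xi> s" "Y s - H \<zeta> s"] by (simp add: norm_minus_commute)
          also have "\<dots> \<le> C * norm (\<xi> - \<zeta>)" using lip sub \<xi> \<zeta> elim by blast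
          finally have "\<bar>?p - ?q\<bar> * (?p + ?q) \<le> C * norm (\<xi> - \<zeta>) * (2 * \<rho>)"
            using elim by (intro mult_mono) (auto simp: \<open>0 \<le> C\<close>)
          moreover have "\<bar>?p\<^sup>2 - ?q\<^sup>2\<bar> = \<bar>?p - ?q\<bar> * (?p + ?q)"
            by (simp add: power2_eq_square square_diff_square_factored abs_mult)
          ultimately show ?case by (simp add: mult_ac)
        qed
      qed (use int \<xi> \<zeta> in auto)
      also have "\<dots> = m * (2 * \<rho> * C) * norm (\<xi> - \<zeta>)" by (simp add: m_def mult_ac)
      finally show "dist (?F \<xi>) (?F \<zeta>) \<le> m * (2 * \<rho> * C) * dist \<xi> \<zeta>"
        by (simp add: dist_norm)
    qed
    have interior: "dist x \<xi> \<le> K * \<delta>" if \<xi>: "\<xi> \<in> cball x R" and le: "?F \<xi> \<le> ?F x" for \<xi>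
    proof -
      \<comment> \<open>The output difference is routed through the data \<open>Y\<close>, so
        coercivity bounds the distance by the two costs. Both are at most the cost at
        \<open>x\<close>, where the residual is bounded by \<delta>.\<close>
      have "c * (norm (x - \<xi>))\<^sup>2 \<le> (\<integral>s. (norm (H x s - H \<xi> s))\<^sup>2 \<partial>M)"
        using coercive sub \<xi> xR by blast
      also have "\<dots> \<le> (\<integral>s. 2 * (norm (Y s - H \<xi> s))\<^sup>2 + 2 * (norm (Y s - H x s))\<^sup>2 \<partial>M)"
      proof (rule integral_mono)
        fix s
        have "norm (H x s - H \<xi> s) \<le> norm (Y s - H \<xi> s) + norm (Y s - H x s)"
          using norm_triangle_ineq4[of "Y s - H \<xi> s" "Y s - H x s"] by simp
        then have "(norm (H x s - H \<xi> s))\<^sup>2 \<le> (norm (Y s - H \<xi> s) + norm (Y s - H x s))\<^sup>2"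
          by (simp add: power_mono)
        also have "\<dots> \<le> 2 * (norm (Y s - H \<xi> s))\<^sup>2 + 2 * (norm (Y s - H x s))\<^sup>2"
          using sum_squares_bound[of "norm (Y s - H \<xi> s)" "norm (Y s - H x s)"]
          by (simp add: power2_sum)
        finally show "(norm (H x s - H \<xi> s))\<^sup>2 \<le> 2 * (norm (Y s - H \<xi> s))\<^sup>2 + 2 * (norm (Y s - H x s))\<^sup>2" .
      qed (use int intd \<xi> xR in auto)
      also have "\<dots> = 2 * ?F \<xi> + 2 * ?F x" using int[OF \<xi>] int[OF xR] by simp
      also have "\<dots> \<le> 4 * ?F x" using le by simp
      also have "?F x \<le> (\<integral>s. \<delta>\<^sup>2 \<partial>M)"
        by (rule integral_mono_AE[OF int[OF xR]])
          (use near in \<open>auto elim!: eventually_mono intro: power_mono\<close>)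
      finally have "c * (norm (x - \<xi>))\<^sup>2 \<le> 4 * (m * \<delta>\<^sup>2)" by (simp add: m_def)
      then have "(norm (x - \<xi>))\<^sup>2 \<le> (2 * sqrt (m / c) * \<delta>)\<^sup>2"
        using \<open>0 < c\<close> \<open>0 \<le> m\<close> by (simp add: power_mult_distrib field_simps)
      then have "norm (x - \<xi>) \<le> 2 * sqrt (m / c) * \<delta>"
        by (rule power2_le_imp_le) (use \<delta> \<open>0 < c\<close> \<open>0 \<le> m\<close> in simp)
      then show ?thesis using \<delta> by (simp add: K_def dist_norm algebra_simps)
    qed
    note res = strictly_convex_unique_local_solution[OF \<open>0 < R\<close> cont conv interior \<open>K * \<delta> < R\<close>]
    show ?case using res by (auto simp: dist_norm norm_minus_commute)
  qed
qed

section \<open>Inputs, disturbances and solutions\<close>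

text \<open>One-sided limits give a bound near each point, and bisection glues these local bounds
  together.\<close>

lemma piecewise_continuous_bounded:
  fixes u :: "real \<Rightarrow> 'a::real_normed_vector"
  assumes "piecewise_continuous u" "0 \<le> b"
  obtains M where "0 \<le> M" "\<And>s. s \<in> {0..b} \<Longrightarrow> norm (u s) \<le> M"
proof -
  \<comment> \<open>The guard \<open>0 \<le> s\<close> matters for the local step: the small
    intervals around 0 may reach into the negative reals, where \<open>u\<close> is
    arbitrary.\<close>
  have "\<exists>M. \<forall>s\<in>{0..b}. 0 \<le> s \<longrightarrow> norm (u s) \<le> M"
  proof (rule Bolzano[OF \<open>0 \<le> b\<close>, where P = "\<lambda>p q. \<exists>M. \<forall>s\<in>{p..q}. 0 \<le> s \<longrightarrow> norm (u s) \<le> M"])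
    fix p q r :: real assume "\<exists>M. \<forall>s\<in>{p..q}. 0 \<le> s \<longrightarrow> norm (u s) \<le> M"
      "\<exists>M. \<forall>s\<in>{q..r}. 0 \<le> s \<longrightarrow> norm (u s) \<le> M"
    then obtain M1 M2 where "\<forall>s\<in>{p..q}. 0 \<le> s \<longrightarrow> norm (u s) \<le> M1"
      "\<forall>s\<in>{q..r}. 0 \<le> s \<longrightarrow> norm (u s) \<le> M2" by blast
    then have "norm (u s) \<le> max M1 M2" if "s \<in> {p..r}" "0 \<le> s" for s
      using that by (cases "s \<le> q") (simp_all add: le_max_iff_disj)
    then show "\<exists>M. \<forall>s\<in>{p..r}. 0 \<le> s \<longrightarrow> norm (u s) \<le> M" by blast
  next
    fix x :: real assume x: "0 \<le> x" "x \<le> b"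
    have lim: "eventually (\<lambda>s. norm (u s) < norm l + 1) F" if "(u \<longlongrightarrow> l) F" for l F
      using tendsto_norm[OF that] by (rule order_tendstoD) simp
    obtain l where "(u \<longlongrightarrow> l) (at_right x)"
      using assms(1) x unfolding piecewise_continuous_def by blast
    from lim[OF this] obtain y where y: "y > x" "\<And>s. x < s \<Longrightarrow> s < y \<Longrightarrow> norm (u s) < norm l + 1"
      by (auto simp: eventually_at_right_field)
    have "\<exists>z<x. \<exists>m. \<forall>s. z < s \<and> s < x \<and> 0 \<le> s \<longrightarrow> norm (u s) \<le> m"
    proof (cases "x = 0")
      case True
      then show ?thesis by (intro exI[of _ "-1"]) auto
    next
      case False
      then obtain l' where "(u \<longlongrightarrow> l') (at_left x)"
        using assms(1) x unfolding piecewise_continuous_def by force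
      from lim[OF this] show ?thesis
        unfolding eventually_at_left_field by (meson less_imp_le)
    qed
    then obtain z m where z: "z < x" "\<And>s. z < s \<Longrightarrow> s < x \<Longrightarrow> 0 \<le> s \<Longrightarrow> norm (u s) \<le> m" by blast
    \<comment> \<open>The one-sided limits say nothing about the value at \<open>x\<close> itself,
      which is therefore included.\<close>
    let ?M = "max (norm (u x)) (max m (norm l + 1))"
    have M: "norm (u s) \<le> ?M" if "z < s" "s < y" "0 \<le> s" for s
      using that y(2)[of s] z(2)[of s] by (cases s x rule: linorder_cases) auto
    show "\<exists>d>0. \<forall>p q. p \<le> x \<and> x \<le> q \<and> q - p < d \<longrightarrow>
        (\<exists>M. \<forall>s\<in>{p..q}. 0 \<le> s \<longrightarrow> norm (u s) \<le> M)"
    proof (rule exI[of _ "min (y - x) (x - z)"], intro conjI allI impI)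
      show "0 < min (y - x) (x - z)" using y z by simp
      fix p q assume "p \<le> x \<and> x \<le> q \<and> q - p < min (y - x) (x - z)"
      then have "\<forall>s\<in>{p..q}. 0 \<le> s \<longrightarrow> norm (u s) \<le> ?M"
        by (intro ballI impI M) auto
      then show "\<exists>M. \<forall>s\<in>{p..q}. 0 \<le> s \<longrightarrow> norm (u s) \<le> M" by blast
    qed
  qed
  then obtain M where M: "\<And>s. s \<in> {0..b} \<Longrightarrow> norm (u s) \<le> M"
    by (metis atLeastAtMost_iff)
  moreover have "0 \<le> M" using M[of 0] \<open>0 \<le> b\<close> norm_ge_zero[of "u 0"] by (simp del: norm_ge_zero)
  ultimately show ?thesis using that by blast
qed

text \<open>Off the finite set \<open>E\<close> of discontinuities the input is continuous, and
  altering a function on a countable set preserves measurability.\<close>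

lemma piecewise_continuous_measurable:
  fixes u :: "real \<Rightarrow> 'a::euclidean_space"
  assumes "piecewise_continuous u" "0 \<le> a" "a \<le> b"
  shows "u \<in> borel_measurable (lebesgue_on {a..b})"
proof -
  define E where "E = {s \<in> {0..b}. \<not> continuous (at s within {0..}) u}"
  have "finite E" using assms unfolding piecewise_continuous_def E_def by auto
  then have E: "E \<in> sets lebesgue" by (simp add: finite_imp_closed)
  have "continuous_on ({a..b} - E) u"
    unfolding continuous_on_eq_continuous_within
  proof
    fix s assume s: "s \<in> {a..b} - E"
    then have "continuous (at s within {0..}) u" using assms by (auto simp: E_def)
    then show "continuous (at s within {a..b} - E) u"
      by (rule continuous_within_subset) (use assms in auto)
  qed
  then have "u \<in> borel_measurable (lebesgue_on ({a..b} - E))"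
    by (rule continuous_imp_measurable_on_sets_lebesgue) (use E in auto)
  then have "(\<lambda>s. if s \<in> {a..b} - E then u s else 0) \<in> borel_measurable lebesgue"
    by (subst borel_measurable_if) (use E in auto)
  then have "(\<lambda>s. if s \<in> {a..b} then u s else 0) \<in> borel_measurable lebesgue"
    by (rule measurable_discrete_difference[where X = E])
      (use \<open>finite E\<close> in \<open>auto intro: countable_finite\<close>)
  then show ?thesis by (subst (asm) borel_measurable_if) auto
qed

lemma Linf_AE_norm_le:
  assumes "g \<in> Linf I"
  shows "AE s in lebesgue_on I. norm (g s) \<le> Linf_norm I g"
proof -
  let ?e = "esssup (lebesgue_on I) (\<lambda>s. ereal (norm (g s)))"
  have "?e < \<infinity>" using assms by (simp add: Linf_def)
  have "AE s in lebesgue_on I. ereal (norm (g s)) \<le> ?e" by (rule esssup_AE)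
  then show ?thesis
    unfolding Linf_norm_def
    \<comment> \<open>\<open>real_of_ereal\<close> sends both infinities to 0. The upper one is
      excluded by membership in \<open>Linf\<close>, the lower one contradicts the norm bound
      itself.\<close>
    by eventually_elim (use \<open>?e < \<infinity>\<close> in \<open>cases ?e; simp\<close>)
qed

lemma solves_on_initial_part:
  assumes "solves_on f u w a b \<xi> x" "s \<le> b"
  shows "solves_on f u w a s \<xi> x"
proof -
  have sub: "{a..s} \<subseteq> {a..b}" using assms by auto
  have "AE r in lebesgue_on {a..s}.
      (x has_vector_derivative f (x r, u r) + w r) (at r within {a..b})"
    by (rule AE_lebesgue_on_subinterval[where a = a and b = b])
      (use assms in \<open>auto simp: solves_on_def\<close>)
  then have "AE r in lebesgue_on {a..s}.
      (x has_vector_derivative f (x r, u r) + w r) (at r within {a..s})"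
    by eventually_elim (rule has_vector_derivative_within_subset[OF _ sub])
  then show ?thesis
    using assms abs_continuous_on_subinterval[of a b x a s] by (auto simp: solves_on_def)
qed

lemma solves_on_final_part:
  assumes "solves_on f u w a b \<xi> x" "a \<le> s"
  shows "solves_on f u w s b (x s) x"
proof -
  have sub: "{s..b} \<subseteq> {a..b}" using assms by auto
  have "AE r in lebesgue_on {s..b}.
      (x has_vector_derivative f (x r, u r) + w r) (at r within {a..b})"
    by (rule AE_lebesgue_on_subinterval[where a = a and b = b])
      (use assms in \<open>auto simp: solves_on_def\<close>)
  then have "AE r in lebesgue_on {s..b}.
      (x has_vector_derivative f (x r, u r) + w r) (at r within {s..b})"
    by eventually_elim (rule has_vector_derivative_within_subset[OF _ sub])
  then show ?thesis
    using assms abs_continuous_on_subinterval[of a b x s b] by (auto simp: solves_on_def)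
qed

text \<open>For each end time \<open>s\<close> the flow describes a solution on its own interval
  \<open>{a..s}\<close>; uniqueness identifies all these end values with the values of one solution
  on \<open>{a..b}\<close>.\<close>

lemma pert_flow_eq:
  assumes "uniquely_solvable f u w a s \<xi>" "solves_on f u w a b \<xi> x" "a \<le> s" "s \<le> b"
  shows "pert_flow f s a \<xi> u w = x s"
proof -
  have "solves_on f u w a s \<xi> x" using solves_on_initial_part assms by blast
  then show ?thesis
    unfolding pert_flow_def using assms(1,3) unfolding uniquely_solvable_def
    by (intro the_equality) auto
qed

text \<open>The Lipschitz bound holds on a ball only, and \<open>Q\<close> leaves room for a tube of
  radius 1 around \<open>x\<close>. Condition \<open>small\<close> makes the Gronwall bound less
  than this radius, so the continuity argument with threshold 1 applies. With
  \<open>\<omega> = 0\<close> it compares initial values, with \<open>\<xi> = \<zeta>\<close> it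
  measures the effect of process noise.\<close>

lemma solution_difference_bound:
  assumes x: "solves_on f u (\<lambda>_. 0) a b \<xi> x" and z: "solves_on f u w a b \<zeta> z"
    and w: "AE s in lebesgue_on {a..b}. norm (w s) \<le> \<omega>" and "0 \<le> \<omega>" "0 \<le> L"
    and lip: "\<And>p q. p \<in> cball 0 Q \<Longrightarrow> q \<in> cball 0 Q \<Longrightarrow> norm (f p - f q) \<le> L * norm (p - q)"
    and Q: "\<And>s. s \<in> {a..b} \<Longrightarrow> norm (x s) + norm (u s) + 1 \<le> Q"
    and small: "(norm (\<zeta> - \<xi>) + \<omega> * (b - a)) * exp (L * (b - a)) < 1"
    and s: "s \<in> {a..b}"
  shows "norm (z s - x s) \<le> (norm (\<zeta> - \<xi>) + \<omega> * (b - a)) * exp (L * (b - a))"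
proof -
  have init: "z a - x a = \<zeta> - \<xi>" using x z by (simp add: solves_on_def)
  have "AE s in lebesgue_on {a..b}. norm (z s - x s) \<le> 1 \<longrightarrow>
        (\<exists>D. ((\<lambda>s. z s - x s) has_vector_derivative D) (at s within {a..b}) \<and>
          norm D \<le> L * norm (z s - x s) + \<omega>)"
  proof -
    have "AE s in lebesgue_on {a..b}. (x has_vector_derivative f (x s, u s) + 0) (at s within {a..b})"
      "AE s in lebesgue_on {a..b}. (z has_vector_derivative f (z s, u s) + w s) (at s within {a..b})"
      using x z by (auto simp: solves_on_def)
    then show ?thesis using w AE_space
    proof eventually_elim
      case (elim s)
      let ?D = "f (z s, u s) + w s - (f (x s, u s) + 0)"
      have "norm ?D \<le> L * norm (z s - x s) + \<omega>" if le: "norm (z s - x s) \<le> 1"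
      proof -
        have Qs: "norm (x s) + norm (u s) + 1 \<le> Q" using elim Q by simp
        have "norm (z s) \<le> norm (x s) + 1" using le norm_triangle_sub[of "z s" "x s"] by simp
        then have "norm (f (z s, u s) - f (x s, u s)) \<le> L * norm ((z s, u s) - (x s, u s))"
          using norm_Pair_le[of "z s" "u s"] norm_Pair_le[of "x s" "u s"] Qs by (intro lip) auto
        then have "norm (f (z s, u s) - f (x s, u s)) \<le> L * norm (z s - x s)"
          by (simp add: norm_Pair)
        then show ?thesis
          using elim norm_triangle_ineq[of "f (z s, u s) - f (x s, u s)" "w s"]
          by (simp add: algebra_simps)
      qed
      then show ?case using has_vector_derivative_diff[OF elim(2) elim(1)] by blast
    qed
  qed
  from abs_continuous_on_gronwall_bootstrap[OF _ \<open>0 \<le> L\<close> \<open>0 \<le> \<omega>\<close> this _ s]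
  show ?thesis
    using x z small by (simp add: init solves_on_def abs_continuous_on_diff)
qed

text \<open>The convex combination of two solutions solves the equation up to the affinity defect of
  \<open>f\<close>, which is at most \<open>B * (l * (1 - l)) * d\<^sup>2\<close>. Its difference
  from the true solution \<open>z\<close> starts at 0, so Gronwall's inequality preserves both the
  weight and the quadratic order.\<close>

lemma solution_affine_defect_bound:
  assumes x: "solves_on f u (\<lambda>_. 0) a b \<xi> x" and y: "solves_on f u (\<lambda>_. 0) a b \<zeta> y"
    and z: "solves_on f u (\<lambda>_. 0) a b ((1 - l) *\<^sub>R \<xi> + l *\<^sub>R \<zeta>) z"
    and l: "0 \<le> l" "l \<le> 1" and "0 \<le> L" "0 \<le> B"
    and lip: "\<And>p q. p \<in> cball 0 Q \<Longrightarrow> q \<in> cball 0 Q \<Longrightarrow> norm (f p - f q) \<le> L * norm (p - q)"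
    and aff: "\<And>p q. p \<in> cball 0 Q \<Longrightarrow> q \<in> cball 0 Q \<Longrightarrow>
       norm (f ((1 - l) *\<^sub>R p + l *\<^sub>R q) - ((1 - l) *\<^sub>R f p + l *\<^sub>R f q))
         \<le> B * (l * (1 - l)) * (norm (p - q))\<^sup>2"
    and Q: "\<And>s. s \<in> {a..b} \<Longrightarrow> norm (x s) + norm (u s) \<le> Q"
       "\<And>s. s \<in> {a..b} \<Longrightarrow> norm (y s) + norm (u s) \<le> Q"
       "\<And>s. s \<in> {a..b} \<Longrightarrow> norm (z s) + norm (u s) \<le> Q"
    and d: "\<And>s. s \<in> {a..b} \<Longrightarrow> norm (x s - y s) \<le> d"
    and s: "s \<in> {a..b}"
  shows "norm (z s - ((1 - l) *\<^sub>R x s + l *\<^sub>R y s))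
      \<le> B * (l * (1 - l)) * d\<^sup>2 * (b - a) * exp (L * (b - a))"
proof -
  let ?c = "\<lambda>s. (1 - l) *\<^sub>R x s + l *\<^sub>R y s"
  let ?e = "\<lambda>s. z s - ?c s"
  let ?\<omega> = "B * (l * (1 - l)) * d\<^sup>2"
  have "0 \<le> l * (1 - l)" using l by simp
  then have "0 \<le> ?\<omega>" using \<open>0 \<le> B\<close> by simp
  have init: "?e a = 0" using x y z by (simp add: solves_on_def)
  have "AE s in lebesgue_on {a..b}. \<exists>D. (?e has_vector_derivative D) (at s within {a..b}) \<and>
          norm D \<le> L * norm (?e s) + ?\<omega>"
  proof -
    have "AE s in lebesgue_on {a..b}. (x has_vector_derivative f (x s, u s)) (at s within {a..b})"
      "AE s in lebesgue_on {a..b}. (y has_vector_derivative f (y s, u s)) (at s within {a..b})"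
      "AE s in lebesgue_on {a..b}. (z has_vector_derivative f (z s, u s)) (at s within {a..b})"
      using x y z by (auto simp: solves_on_def)
    then show ?thesis using AE_space
    proof eventually_elim
      case (elim s)
      then have s: "s \<in> {a..b}" by simp
      let ?D = "f (z s, u s) - ((1 - l) *\<^sub>R f (x s, u s) + l *\<^sub>R f (y s, u s))"
      have "(?e has_vector_derivative ?D) (at s within {a..b})"
        using elim by (auto intro!: derivative_eq_intros)
      moreover have "norm ?D \<le> L * norm (?e s) + ?\<omega>"
      proof -
        have mem: "(x s, u s) \<in> cball 0 Q" "(y s, u s) \<in> cball 0 Q" "(z s, u s) \<in> cball 0 Q"
          using norm_Pair_le[of "x s" "u s"] norm_Pair_le[of "y s" "u s"] norm_Pair_le[of "z s" "u s"]
            Q[OF s] by auto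
        have c: "(?c s, u s) = (1 - l) *\<^sub>R (x s, u s) + l *\<^sub>R (y s, u s)"
          by (simp add: algebra_simps)
        then have memc: "(?c s, u s) \<in> cball 0 Q"
          using convexD_alt[OF convex_cball mem(1,2) l] by simp
        have "norm (f (z s, u s) - f (?c s, u s)) \<le> L * norm ((z s, u s) - (?c s, u s))"
          by (rule lip[OF mem(3) memc])
        also have "\<dots> = L * norm (?e s)" by (simp add: norm_Pair)
        finally have 1: "norm (f (z s, u s) - f (?c s, u s)) \<le> L * norm (?e s)" .
        have "norm (f (?c s, u s) - ((1 - l) *\<^sub>R f (x s, u s) + l *\<^sub>R f (y s, u s)))
            \<le> B * (l * (1 - l)) * (norm ((x s, u s) - (y s, u s)))\<^sup>2"
          unfolding c by (rule aff[OF mem(1,2)])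
        also have "\<dots> \<le> ?\<omega>"
          using d[OF s] \<open>0 \<le> B\<close> \<open>0 \<le> l * (1 - l)\<close>
          by (intro mult_left_mono power_mono) (auto simp: norm_Pair)
        finally show ?thesis
          using 1 norm_diff_triangle_le[of "f (z s, u s)" "f (?c s, u s)"] by blast
      qed
      ultimately show ?case by blast
    qed
  qed
  from abs_continuous_on_gronwall[OF _ \<open>0 \<le> L\<close> \<open>0 \<le> ?\<omega>\<close> this s]
  show ?thesis
    using x y z init
    by (simp add: solves_on_def abs_continuous_on_diff abs_continuous_on_add abs_continuous_on_scaleR)
qed

lemma set_lebesgue_integral_restrict:
  fixes g :: "'a \<Rightarrow> 'b::{banach, second_countable_topology}"
  assumes "S \<in> sets M"
  shows "set_lebesgue_integral M S g = (\<integral>s. g s \<partial>(restrict_space M S))"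
  unfolding set_lebesgue_integral_def using assms
  by (subst integral_restrict_space) (auto dest: sets.sets_into_space simp: Int_absorb2)

theorem theorem4p23:
  fixes f :: "(real^'nx) \<times> (real^'nu) \<Rightarrow> real^'nx"
    and h :: "(real^'nx) \<times> (real^'nu) \<Rightarrow> real^'ny"
    and U :: "(real^'nu) set"
    and x0 :: "real^'nx"
    and u :: "real \<Rightarrow> real^'nu"
  assumes f_C2: "C2 f"
    and h_C2: "C2 h"
    and solvable: "\<And>u' s1 s2 \<xi>. input_trajectory U u' \<Longrightarrow> 0 \<le> s1 \<Longrightarrow> s1 \<le> s2 \<Longrightarrow>
          uniquely_solvable f u' (\<lambda>_. 0) s1 s2 \<xi>"
    and pert_solvable: "\<And>u' t w s1 s2 \<xi>. input_trajectory U u' \<Longrightarrow> w \<in> Linf {0..t} \<Longrightarrow>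
          0 \<le> s1 \<Longrightarrow> s1 \<le> s2 \<Longrightarrow> s2 \<le> t \<Longrightarrow> uniquely_solvable f u' w s1 s2 \<xi>"
    and input: "input_trajectory U u"
    and persistent: "\<exists>T R \<kappa>. weakly_persistent_with f h x0 u T R \<kappa> \<and>
          (\<forall>t\<ge>T. finite_sensitivity TYPE('nx) (\<kappa> t))"
  shows "\<exists>T>0. \<forall>t\<ge>T. \<exists>\<nu>>0. \<exists>R>0. \<exists>K>0. \<forall>\<eta> \<in> Theta_ball t T \<nu>.
           (\<exists>!\<xi>. \<xi> \<in> cball (flow f (t-T) 0 x0 u) R \<and>
                  local_solution (\<lambda>\<zeta>. mh_cost f h x0 (t-T) t \<zeta> u \<eta>) \<xi>) \<and>
           (\<forall>\<xi>. \<xi> \<in> cball (flow f (t-T) 0 x0 u) R \<and>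
                  local_solution (\<lambda>\<zeta>. mh_cost f h x0 (t-T) t \<zeta> u \<eta>) \<xi> \<longrightarrow>
                norm (\<xi> - flow f (t-T) 0 x0 u) \<le> K * Theta_norm t T \<eta>)"
proof -
  obtain T Rp \<kappa> where wp: "weakly_persistent_with f h x0 u T Rp \<kappa>"
    and sens: "\<And>t. t \<ge> T \<Longrightarrow> finite_sensitivity TYPE('nx) (\<kappa> t)"
    using persistent by blast
  have "T > 0" using wp by (simp add: weakly_persistent_with_def)
  show ?thesis
  \<comment> \<open>The persistence horizon itself serves as the witness.\<close>
  proof (rule exI[of _ T], intro conjI allI impI)
    show "T > 0" by fact
    fix t assume "t \<ge> T"

    \<comment> \<open>Reference solution and constants valid near it\<close>
    define a where "a = t - T"
    have a: "0 \<le> a" "a < t" "0 < t" "a \<le> t" using \<open>T > 0\<close> \<open>t \<ge> T\<close> by (auto simp: a_def)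
    have sub: "{a..t} \<subseteq> {0..t}" using a by auto
    have interval: "{a..t} \<in> sets lebesgue" by simp
    have pc: "piecewise_continuous u" using input by (simp add: input_trajectory_def)
    obtain xr where xr: "solves_on f u (\<lambda>_. 0) 0 t x0 xr"
      using solvable[OF input, of 0 t x0] a by (auto simp: uniquely_solvable_def)
    define xa where "xa = xr a"
    have xa: "flow f a 0 x0 u = xa"
      unfolding flow_def xa_def using a by (intro pert_flow_eq[OF solvable[OF input] xr]) auto
    have "continuous_on {0..t} xr"
      using xr by (simp add: solves_on_def abs_continuous_on_imp_continuous_on)
    then have "bounded (xr ` {0..t})"
      by (intro compact_imp_bounded compact_continuous_image) auto
    then obtain Mx where Mx: "\<And>s. s \<in> {0..t} \<Longrightarrow> norm (xr s) \<le> Mx"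
      unfolding bounded_iff by (metis imageI)
    obtain Mu where Mu: "\<And>s. s \<in> {0..t} \<Longrightarrow> norm (u s) \<le> Mu"
      using piecewise_continuous_bounded[OF pc, of t] a by auto
    \<comment> \<open>One unit is the tube around the reference that contains the neighbouring
      solutions; the second is a tube around each of these, since they are also compared with each
      other.\<close>
    define Q where "Q = Mx + Mu + 2"
    obtain L B where "0 \<le> L" "0 \<le> B"
      and f_lip: "\<And>p q. p \<in> cball 0 Q \<Longrightarrow> q \<in> cball 0 Q \<Longrightarrow> norm (f p - f q) \<le> L * norm (p - q)"
      and f_aff: "\<And>p q l. p \<in> cball 0 Q \<Longrightarrow> q \<in> cball 0 Q \<Longrightarrow> 0 \<le> l \<Longrightarrow> l \<le> 1 \<Longrightarrow>
        norm (f ((1 - l) *\<^sub>R p + l *\<^sub>R q) - ((1 - l) *\<^sub>R f p + l *\<^sub>R f q))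
          \<le> B * (l * (1 - l)) * (norm (p - q))\<^sup>2"
      using C2_cball_bounds[OF f_C2, of Q] by metis
    obtain Lh Bh where "0 \<le> Lh" "0 \<le> Bh"
      and h_lip: "\<And>p q. p \<in> cball 0 Q \<Longrightarrow> q \<in> cball 0 Q \<Longrightarrow> norm (h p - h q) \<le> Lh * norm (p - q)"
      and h_aff: "\<And>p q l. p \<in> cball 0 Q \<Longrightarrow> q \<in> cball 0 Q \<Longrightarrow> 0 \<le> l \<Longrightarrow> l \<le> 1 \<Longrightarrow>
        norm (h ((1 - l) *\<^sub>R p + l *\<^sub>R q) - ((1 - l) *\<^sub>R h p + l *\<^sub>R h q))
          \<le> Bh * (l * (1 - l)) * (norm (p - q))\<^sup>2"
      using C2_cball_bounds[OF h_C2, of Q] by metis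
    have h_cont: "continuous_on UNIV h"
      using h_C2 unfolding C2_def
      by (meson continuous_at_imp_continuous_on has_derivative_continuous)
    have h_meas: "(\<lambda>s. h (z s, u s)) \<in> borel_measurable (lebesgue_on {a..t})"
      if "continuous_on {a..t} z" for z
    proof -
      have "(\<lambda>s. (z s, u s)) \<in> borel_measurable (lebesgue_on {a..t})"
        using piecewise_continuous_measurable[OF pc a(1,4)]
          continuous_imp_measurable_on_sets_lebesgue[OF that interval] by (rule borel_measurable_Pair[rotated])
      then show ?thesis by (rule borel_measurable_continuous_on[OF h_cont])
    qed
    have mem: "(z, u s) \<in> cball 0 Q" if "norm z + norm (u s) \<le> Q" for z s
      using that norm_Pair_le[of z "u s"] by simp

    \<comment> \<open>Solutions as functions of the initial state\<close>
    define \<phi> where "\<phi> = (\<lambda>\<xi>. SOME x. solves_on f u (\<lambda>_. 0) a t \<xi> x)"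
    have \<phi>: "solves_on f u (\<lambda>_. 0) a t \<xi> (\<phi> \<xi>)" for \<xi>
      using someI_ex[of "solves_on f u (\<lambda>_. 0) a t \<xi>"] solvable[OF input a(1,4), of \<xi>]
      unfolding \<phi>_def uniquely_solvable_def by blast
    have flow: "flow f s a \<xi> u = \<phi> \<xi> s" if "s \<in> {a..t}" for s \<xi>
      unfolding flow_def by (rule pert_flow_eq[OF solvable[OF input] \<phi>]) (use that a in auto)
    have xr_a: "solves_on f u (\<lambda>_. 0) a t xa xr"
      unfolding xa_def by (rule solves_on_final_part[OF xr]) (use a in auto)
    \<comment> \<open>Hence \<open>H xa\<close>, defined below, is the noise-free output along the
      reference.\<close>
    have \<phi>_xa: "\<phi> xa s = xr s" if "s \<in> {a..t}" for s
      using solvable[OF input, of a t xa] \<phi>[of xa] xr_a a that unfolding uniquely_solvable_def by blast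
    have xr_Q: "norm (xr s) + norm (u s) + 2 \<le> Q" if "s \<in> {0..t}" for s
      using Mx[OF that] Mu[OF that] by (simp add: Q_def)
    define G where "G = exp (L * (t - a))"
    have "0 < G" by (simp add: G_def)

    \<comment> \<open>Quadratic persistence and the radius of the working ball\<close>
    obtain r where "r > 0" and INF: "(INF \<xi>\<in>{\<xi>::real^'nx. 0 < norm \<xi> \<and> norm \<xi> \<le> r}.
        \<kappa> t (norm \<xi>) / (norm \<xi>)\<^sup>2) > 0" (is "?c > 0")
      using sens[OF \<open>t \<ge> T\<close>] unfolding finite_sensitivity_def by blast
    have K: "K_function (\<kappa> t)" and "Rp t > 0"
      and persist: "\<And>\<xi> \<zeta>. \<xi> \<in> cball xa (Rp t) \<Longrightarrow> \<zeta> \<in> cball xa (Rp t) \<Longrightarrow>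
        output_error f h a t \<xi> \<zeta> u \<ge> \<kappa> t (norm (\<xi> - \<zeta>))"
      using conjunct2[OF wp[unfolded weakly_persistent_with_def], rule_format, OF \<open>t \<ge> T\<close>]
      unfolding a_def[symmetric] xa by auto
    have \<kappa>_lower: "?c * (norm d)\<^sup>2 \<le> \<kappa> t (norm d)" if "norm d \<le> r" for d :: "real^'nx"
    proof (cases "d = 0")
      case True
      then show ?thesis using K by (simp add: K_function_def)
    next
      case False
      \<comment> \<open>The real infimum is a lower bound only if the quotients are bounded below; 0
        is such a bound.\<close>
      have "0 \<le> \<kappa> t s" if "0 \<le> s" for s
        using K that strict_mono_on_leD[of "{0..}" "\<kappa> t" 0 s] by (simp add: K_function_def)
      then have "?c \<le> \<kappa> t (norm d) / (norm d)\<^sup>2"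
        using that False by (intro cINF_lower bdd_belowI2[of _ 0]) auto
      then show ?thesis using False by (simp add: field_simps)
    qed
    \<comment> \<open>Two points of the ball differ by at most \<open>2 * R\<^sub>0\<close>: this
      must not exceed the sensitivity radius \<open>r\<close>, and after the Gronwall factor
      \<open>G\<close> it must stay below the tube radius 1.\<close>
    define R\<^sub>0 where "R\<^sub>0 = min (min (Rp t) (r / 2)) (1 / (2 * G + 1))"
    have R0: "0 < R\<^sub>0" "R\<^sub>0 \<le> Rp t" "2 * R\<^sub>0 \<le> r" "2 * R\<^sub>0 * G < 1" "R\<^sub>0 * G < 1"
    proof -
      show "0 < R\<^sub>0" "R\<^sub>0 \<le> Rp t" "2 * R\<^sub>0 \<le> r"
        using \<open>Rp t > 0\<close> \<open>r > 0\<close> \<open>0 < G\<close> by (auto simp: R\<^sub>0_def)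
      have "R\<^sub>0 * (2 * G + 1) \<le> 1 / (2 * G + 1) * (2 * G + 1)"
        using \<open>0 < G\<close> by (intro mult_right_mono) (auto simp: R\<^sub>0_def)
      then have "R\<^sub>0 * (2 * G + 1) \<le> 1" using \<open>0 < G\<close> by simp
      then show "2 * R\<^sub>0 * G < 1" using \<open>0 < R\<^sub>0\<close> by (simp add: algebra_simps)
      then show "R\<^sub>0 * G < 1" using mult_pos_pos[OF \<open>0 < R\<^sub>0\<close> \<open>0 < G\<close>] by linarith
    qed
    have zero: "AE s in lebesgue_on {a..t}. norm (0 :: real^'nx) \<le> 0" by simp
    have \<phi>_Q: "norm (\<phi> \<xi> s) + norm (u s) + 1 \<le> Q" if \<xi>: "\<xi> \<in> cball xa R\<^sub>0" and s: "s \<in> {a..t}" for \<xi> s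
    proof -
      have \<xi>G: "norm (\<xi> - xa) * G < 1"
      proof -
        have "norm (\<xi> - xa) * G \<le> R\<^sub>0 * G"
          using \<xi> \<open>0 < G\<close> by (intro mult_right_mono) (auto simp: dist_norm norm_minus_commute)
        then show ?thesis using R0 by simp
      qed
      have "norm (\<phi> \<xi> s - xr s) \<le> (norm (\<xi> - xa) + 0 * (t - a)) * exp (L * (t - a))"
      proof (rule solution_difference_bound[OF xr_a \<phi> zero order_refl \<open>0 \<le> L\<close> f_lip _ _ s])
        show "norm (xr s) + norm (u s) + 1 \<le> Q" if "s \<in> {a..t}" for s
          using xr_Q[of s] that sub by auto
        show "(norm (\<xi> - xa) + 0 * (t - a)) * exp (L * (t - a)) < 1"
          using \<xi>G by (simp add: G_def)
      qed
      then have "norm (\<phi> \<xi> s - xr s) < 1" using \<xi>G by (simp add: G_def)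
      then show ?thesis
        using xr_Q[of s] s sub norm_triangle_sub[of "\<phi> \<xi> s" "xr s"] by auto
    qed
    have \<phi>_lip: "norm (\<phi> \<xi> s - \<phi> \<zeta> s) \<le> norm (\<xi> - \<zeta>) * G"
      if \<xi>: "\<xi> \<in> cball xa R\<^sub>0" and \<zeta>: "\<zeta> \<in> cball xa R\<^sub>0" and s: "s \<in> {a..t}" for \<xi> \<zeta> s
    proof -
      have "norm (\<xi> - \<zeta>) \<le> 2 * R\<^sub>0"
        using \<xi> \<zeta> dist_triangle2[of \<xi> \<zeta> xa] by (simp add: dist_commute flip: dist_norm)
      then have "norm (\<xi> - \<zeta>) * G \<le> 2 * R\<^sub>0 * G"
        using \<open>0 < G\<close> by (intro mult_right_mono) auto
      then have small: "norm (\<xi> - \<zeta>) * G < 1" using R0 by simp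
      have "norm (\<phi> \<xi> s - \<phi> \<zeta> s) \<le> (norm (\<xi> - \<zeta>) + 0 * (t - a)) * exp (L * (t - a))"
      proof (rule solution_difference_bound[OF \<phi> \<phi> zero order_refl \<open>0 \<le> L\<close> f_lip \<phi>_Q[OF \<zeta>] _ s])
        show "(norm (\<xi> - \<zeta>) + 0 * (t - a)) * exp (L * (t - a)) < 1"
          using small by (simp add: G_def)
      qed
      then show ?thesis by (simp add: G_def)
    qed
    have \<phi>_mem: "(\<phi> \<xi> s, u s) \<in> cball 0 Q" if "\<xi> \<in> cball xa R\<^sub>0" "s \<in> {a..t}" for \<xi> s
      using \<phi>_Q[OF that] by (intro mem) simp

    \<comment> \<open>The output as a nearly affine, coercive model\<close>
    define H where "H = (\<lambda>\<xi> s. h (\<phi> \<xi> s, u s))"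
    \<comment> \<open>One constant for two bounds: \<open>Lh * G\<close> is the Lipschitz constant
      of the output; the bracket is its affinity defect, namely that of the flow passed through
      \<open>h\<close> plus that of \<open>h\<close> itself at states up to \<open>G\<close> times
      as far apart as the initial ones.\<close>
    define C where "C = Lh * G + (Lh * (B * G\<^sup>2 * (t - a) * G) + Bh * G\<^sup>2)"
    have C: "0 \<le> C" "Lh * G \<le> C" "Lh * (B * G\<^sup>2 * (t - a) * G) + Bh * G\<^sup>2 \<le> C"
      using \<open>0 \<le> Lh\<close> \<open>0 < G\<close> \<open>0 \<le> B\<close> \<open>0 \<le> Bh\<close> a by (auto simp: C_def)
    have fin: "finite_measure (lebesgue_on {a..t})"
      by (rule finite_measure_lebesgue_on) auto
    have H_meas: "H \<xi> \<in> borel_measurable (lebesgue_on {a..t})" for \<xi>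
      unfolding H_def using \<phi>[of \<xi>]
      by (intro h_meas) (simp add: solves_on_def abs_continuous_on_imp_continuous_on)
    have H_lip: "norm (H \<xi> s - H \<zeta> s) \<le> C * norm (\<xi> - \<zeta>)"
      if "\<xi> \<in> cball xa R\<^sub>0" "\<zeta> \<in> cball xa R\<^sub>0" "s \<in> space (lebesgue_on {a..t})" for \<xi> \<zeta> s
    proof -
      have s: "s \<in> {a..t}" using that by simp
      have "norm (H \<xi> s - H \<zeta> s) \<le> Lh * norm ((\<phi> \<xi> s, u s) - (\<phi> \<zeta> s, u s))"
        unfolding H_def by (intro h_lip \<phi>_mem that s)
      also have "\<dots> \<le> Lh * (norm (\<xi> - \<zeta>) * G)"
        using \<phi>_lip[OF that(1,2) s] \<open>0 \<le> Lh\<close> by (intro mult_left_mono) (auto simp: norm_Pair)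
      also have "\<dots> \<le> C * norm (\<xi> - \<zeta>)"
        using mult_right_mono[OF \<open>Lh * G \<le> C\<close> norm_ge_zero[of "\<xi> - \<zeta>"]] by (simp add: mult_ac)
      finally show ?thesis .
    qed
    have H_aff: "norm (H ((1 - l) *\<^sub>R \<xi> + l *\<^sub>R \<zeta>) s - ((1 - l) *\<^sub>R H \<xi> s + l *\<^sub>R H \<zeta> s))
          \<le> C * (l * (1 - l)) * (norm (\<xi> - \<zeta>))\<^sup>2"
      if \<xi>: "\<xi> \<in> cball xa R\<^sub>0" and \<zeta>: "\<zeta> \<in> cball xa R\<^sub>0" and l: "0 \<le> l" "l \<le> 1"
        and s': "s \<in> space (lebesgue_on {a..t})" for \<xi> \<zeta> l s
    proof -
      have s: "s \<in> {a..t}" using s' by simp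
      let ?z = "(1 - l) *\<^sub>R \<xi> + l *\<^sub>R \<zeta>" and ?D = "norm (\<xi> - \<zeta>) * G"
      let ?zs = "(1 - l) *\<^sub>R \<phi> \<xi> s + l *\<^sub>R \<phi> \<zeta> s"
      have z: "?z \<in> cball xa R\<^sub>0" by (rule convexD_alt[OF convex_cball \<xi> \<zeta> l])
      have ll: "0 \<le> l * (1 - l)" using l by simp
      have pair: "(?zs, u s) = (1 - l) *\<^sub>R (\<phi> \<xi> s, u s) + l *\<^sub>R (\<phi> \<zeta> s, u s)"
        by (simp add: algebra_simps)
      have zs: "(?zs, u s) \<in> cball 0 Q"
        unfolding pair by (rule convexD_alt[OF convex_cball \<phi>_mem[OF \<xi> s] \<phi>_mem[OF \<zeta> s] l])
      have e: "norm (\<phi> ?z s - ?zs) \<le> B * (l * (1 - l)) * ?D\<^sup>2 * (t - a) * exp (L * (t - a))"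
      proof (rule solution_affine_defect_bound[OF \<phi> \<phi> \<phi> l \<open>0 \<le> L\<close> \<open>0 \<le> B\<close> f_lip f_aff _ _ _ \<phi>_lip[OF \<xi> \<zeta>] s])
        show "norm (\<phi> \<xi> s) + norm (u s) \<le> Q" "norm (\<phi> \<zeta> s) + norm (u s) \<le> Q"
          "norm (\<phi> ?z s) + norm (u s) \<le> Q" if "s \<in> {a..t}" for s
          using \<phi>_Q[OF \<xi> that] \<phi>_Q[OF \<zeta> that] \<phi>_Q[OF z that] by simp_all
      qed (use l in auto)
      \<comment> \<open>The defect is split at the output of the state \<open>?zs\<close>: up to
        there the flow is responsible, beyond it \<open>h\<close>.\<close>
      have "norm (h (\<phi> ?z s, u s) - h (?zs, u s)) \<le> Lh * norm ((\<phi> ?z s, u s) - (?zs, u s))"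
        by (rule h_lip[OF \<phi>_mem[OF z s] zs])
      also have "\<dots> \<le> Lh * (B * (l * (1 - l)) * ?D\<^sup>2 * (t - a) * G)"
        using e \<open>0 \<le> Lh\<close> by (intro mult_left_mono) (auto simp: norm_Pair G_def)
      finally have 1: "norm (h (\<phi> ?z s, u s) - h (?zs, u s)) \<le> Lh * (B * (l * (1 - l)) * ?D\<^sup>2 * (t - a) * G)" .
      have "norm (h (?zs, u s) - ((1 - l) *\<^sub>R H \<xi> s + l *\<^sub>R H \<zeta> s))
          \<le> Bh * (l * (1 - l)) * (norm ((\<phi> \<xi> s, u s) - (\<phi> \<zeta> s, u s)))\<^sup>2"
        unfolding H_def pair by (rule h_aff[OF \<phi>_mem[OF \<xi> s] \<phi>_mem[OF \<zeta> s] l])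
      also have "\<dots> \<le> Bh * (l * (1 - l)) * ?D\<^sup>2"
        using \<phi>_lip[OF \<xi> \<zeta> s] \<open>0 \<le> Bh\<close> ll
        by (intro mult_left_mono power_mono) (auto simp: norm_Pair)
      finally have 2: "norm (h (?zs, u s) - ((1 - l) *\<^sub>R H \<xi> s + l *\<^sub>R H \<zeta> s)) \<le> Bh * (l * (1 - l)) * ?D\<^sup>2" .
      have "norm (H ?z s - ((1 - l) *\<^sub>R H \<xi> s + l *\<^sub>R H \<zeta> s))
          \<le> Lh * (B * (l * (1 - l)) * ?D\<^sup>2 * (t - a) * G) + Bh * (l * (1 - l)) * ?D\<^sup>2"
        using norm_diff_triangle_le[OF 1 2] by (simp add: H_def)
      also have "\<dots> = (Lh * (B * G\<^sup>2 * (t - a) * G) + Bh * G\<^sup>2) * (l * (1 - l) * (norm (\<xi> - \<zeta>))\<^sup>2)"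
        by (simp add: power_mult_distrib) algebra
      also have "\<dots> \<le> C * (l * (1 - l) * (norm (\<xi> - \<zeta>))\<^sup>2)"
        using ll C(3) by (intro mult_right_mono) auto
      finally show ?thesis by (simp add: mult_ac)
    qed
    have H_coercive: "?c * (norm (\<xi> - \<zeta>))\<^sup>2 \<le> (\<integral>s. (norm (H \<xi> s - H \<zeta> s))\<^sup>2 \<partial>(lebesgue_on {a..t}))"
      if \<xi>: "\<xi> \<in> cball xa R\<^sub>0" and \<zeta>: "\<zeta> \<in> cball xa R\<^sub>0" for \<xi> \<zeta>
    proof -
      have "norm (\<xi> - \<zeta>) \<le> 2 * R\<^sub>0"
        using \<xi> \<zeta> dist_triangle2[of \<xi> \<zeta> xa] by (simp add: dist_commute flip: dist_norm)
      then have "?c * (norm (\<xi> - \<zeta>))\<^sup>2 \<le> \<kappa> t (norm (\<xi> - \<zeta>))"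
        using R0 by (intro \<kappa>_lower) simp
      also have "\<dots> \<le> output_error f h a t \<xi> \<zeta> u"
        by (rule persist) (use \<xi> \<zeta> R0 in auto)
      also have "\<dots> = (\<integral>s. (norm (H \<xi> s - H \<zeta> s))\<^sup>2 \<partial>(lebesgue_on {a..t}))"
        unfolding output_error_def set_lebesgue_integral_restrict[OF interval]
        by (intro Bochner_Integration.integral_cong) (auto simp: H_def flow)
      finally show ?thesis .
    qed
    obtain \<nu> R K' where pos: "0 < \<nu>" "0 < R" "0 < K'" and sol:
      "\<And>Y \<delta>. Y \<in> borel_measurable (lebesgue_on {a..t}) \<Longrightarrow> 0 \<le> \<delta> \<Longrightarrow> \<delta> < \<nu> \<Longrightarrow>
         AE s in lebesgue_on {a..t}. norm (Y s - H xa s) \<le> \<delta> \<Longrightarrow>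
       (\<exists>!\<xi>. \<xi> \<in> cball xa R \<and>
          local_solution (\<lambda>\<zeta>. \<integral>s. (norm (Y s - H \<zeta> s))\<^sup>2 \<partial>(lebesgue_on {a..t})) \<xi>) \<and>
       (\<forall>\<xi>. \<xi> \<in> cball xa R \<and>
          local_solution (\<lambda>\<zeta>. \<integral>s. (norm (Y s - H \<zeta> s))\<^sup>2 \<partial>(lebesgue_on {a..t})) \<xi> \<longrightarrow>
          norm (\<xi> - xa) \<le> K' * \<delta>)"
      by (rule least_squares_local_solution[where x = xa and H = H,
            OF fin C(1) INF R0(1) H_meas H_lip H_aff H_coercive]) (assumption | rule that)+

    \<comment> \<open>Effect of the noise on the data\<close>
    define S where "S = t * exp (L * t)"
    have "0 \<le> S" using a by (simp add: S_def)
    \<comment> \<open>Process noise acts from time 0 on, so \<open>S\<close> is the Gronwall factor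
      for \<open>{0..t}\<close> rather than for the window. In \<open>P\<close> the term
      \<open>Lh * S\<close> accounts for the disturbed state and 1 for the measurement
      noise.\<close>
    define P where "P = Lh * S + 1"
    have "0 < P" using \<open>0 \<le> Lh\<close> \<open>0 \<le> S\<close> by (auto simp: P_def intro: add_nonneg_pos)
    show "\<exists>\<nu>>0. \<exists>R>0. \<exists>K>0. \<forall>\<eta>\<in>Theta_ball t T \<nu>.
           (\<exists>!\<xi>. \<xi> \<in> cball (flow f (t-T) 0 x0 u) R \<and>
                  local_solution (\<lambda>\<zeta>. mh_cost f h x0 (t-T) t \<zeta> u \<eta>) \<xi>) \<and>
           (\<forall>\<xi>. \<xi> \<in> cball (flow f (t-T) 0 x0 u) R \<and>
                  local_solution (\<lambda>\<zeta>. mh_cost f h x0 (t-T) t \<zeta> u \<eta>) \<xi> \<longrightarrow>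
                norm (\<xi> - flow f (t-T) 0 x0 u) \<le> K * Theta_norm t T \<eta>)"
      unfolding a_def[symmetric] xa
    \<comment> \<open>The first bound makes the data error \<open>P * \<theta>\<close> less than
      \<open>\<nu>\<close>; the second gives \<open>\<theta> * S < 1\<close>, which keeps the
      disturbed trajectory in the unit tube.\<close>
    proof (rule exI[of _ "min (\<nu> / P) (1 / (S + 1))"], rule conjI, goal_cases)
      case 1
      show ?case using pos \<open>0 < P\<close> \<open>0 \<le> S\<close> by simp
    next
      case 2
      show ?case
      proof (rule exI[of _ R], rule conjI[OF pos(2)], rule exI[of _ "K' * P"], rule conjI, goal_cases)
        case 1
        show ?case using pos \<open>0 < P\<close> by simp
      next
        case 2
        show ?case
        proof
          fix \<eta> :: "(real \<Rightarrow> real^'ny) \<times> (real \<Rightarrow> real^'nx)"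
          assume \<eta>: "\<eta> \<in> Theta_ball t T (min (\<nu> / P) (1 / (S + 1)))"
          define v where "v = fst \<eta>"
          define w where "w = snd \<eta>"
          define \<theta> where "\<theta> = Theta_norm t T \<eta>"
          have v: "v \<in> Linf {a..t}" and w: "w \<in> Linf {0..t}"
            and \<theta>_less: "\<theta> < \<nu> / P" "\<theta> < 1 / (S + 1)"
            and \<theta>_ge: "Linf_norm {a..t} v \<le> \<theta>" "Linf_norm {0..t} w \<le> \<theta>"
            using \<eta> by (auto simp: Theta_ball_def Theta_def Theta_norm_def v_def w_def \<theta>_def a_def)
          have v_le: "AE s in lebesgue_on {a..t}. norm (v s) \<le> \<theta>"
            using Linf_AE_norm_le[OF v] by eventually_elim (use \<theta>_ge in auto)
          have w_le: "AE s in lebesgue_on {0..t}. norm (w s) \<le> \<theta>"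
            using Linf_AE_norm_le[OF w] by eventually_elim (use \<theta>_ge in auto)
          \<comment> \<open>An almost everywhere bound on a norm determines the sign because the
            window, having positive length, contains a point outside the exceptional set.\<close>
          have "0 \<le> \<theta>"
          proof -
            obtain N where N: "negligible N" "\<And>s. s \<in> {a..t} - N \<Longrightarrow> norm (v s) \<le> \<theta>"
              using AE_lebesgue_on_negligible[OF v_le] by auto
            have "\<not> negligible {a..t}"
              using negligible_interval(1)[of a t] a by (simp add: box_eq_empty)
            then obtain s where "s \<in> {a..t} - N" using N(1) negligible_subset by blast
            then show ?thesis using N(2) order_trans[OF norm_ge_zero] by blast
          qed
          have \<theta>S: "\<theta> * S < 1"
          proof -
            have "\<theta> * (S + 1) < 1" using \<theta>_less(2) \<open>0 \<le> S\<close> by (simp add: field_simps)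
            then show ?thesis using \<open>0 \<le> \<theta>\<close> by (simp add: algebra_simps)
          qed
          obtain xt where xt: "solves_on f u w 0 t x0 xt"
            using pert_solvable[OF input w, of 0 t x0] a by (auto simp: uniquely_solvable_def)
          have pert: "pert_flow f s 0 x0 u w = xt s" if "s \<in> {a..t}" for s
            using that a by (intro pert_flow_eq[OF pert_solvable[OF input w] xt]) auto
          have xt_near: "norm (xt s - xr s) \<le> \<theta> * S" if s: "s \<in> {a..t}" for s
          proof -
            \<comment> \<open>Both trajectories start at \<open>x0\<close>, so only the process
              noise separates them.\<close>
            have "norm (xt s - xr s) \<le> (norm (x0 - x0) + \<theta> * (t - 0)) * exp (L * (t - 0))"
            proof (rule solution_difference_bound[OF xr xt w_le \<open>0 \<le> \<theta>\<close> \<open>0 \<le> L\<close> f_lip])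
              show "norm (xr s) + norm (u s) + 1 \<le> Q" if "s \<in> {0..t}" for s
                using xr_Q[OF that] by simp
              show "(norm (x0 - x0) + \<theta> * (t - 0)) * exp (L * (t - 0)) < 1"
                using \<theta>S by (simp add: S_def mult.assoc)
            qed (use s sub in auto)
            then show ?thesis by (simp add: S_def mult.assoc)
          qed
          define Y where "Y = (\<lambda>s. h (xt s, u s) + v s)"
          have "continuous_on {0..t} xt"
            using xt by (simp add: solves_on_def abs_continuous_on_imp_continuous_on)
          then have Y_meas: "Y \<in> borel_measurable (lebesgue_on {a..t})"
            unfolding Y_def using v continuous_on_subset[OF _ sub]
            by (intro borel_measurable_add h_meas) (auto simp: Linf_def)
          have "AE s in lebesgue_on {a..t}. norm (Y s - H xa s) \<le> P * \<theta>"
            using v_le AE_space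
          proof eventually_elim
            case (elim s)
            then have s: "s \<in> {a..t}" by simp
            have "norm (h (xt s, u s) - h (xr s, u s)) \<le> Lh * norm ((xt s, u s) - (xr s, u s))"
              using xr_Q[of s] s sub xt_near[OF s] \<theta>S norm_triangle_sub[of "xt s" "xr s"]
              by (intro h_lip mem) auto
            also have "\<dots> \<le> Lh * (\<theta> * S)"
              using xt_near[OF s] \<open>0 \<le> Lh\<close> by (intro mult_left_mono) (auto simp: norm_Pair)
            finally show ?case
              using elim norm_triangle_ineq[of "h (xt s, u s) - h (xr s, u s)" "v s"]
              by (simp add: Y_def H_def \<phi>_xa[OF s] P_def algebra_simps)
          qed
          moreover have "P * \<theta> < \<nu>" using \<theta>_less(1) \<open>0 < P\<close> by (simp add: field_simps)
          moreover have "mh_cost f h x0 a t \<zeta> u \<eta> = (\<integral>s. (norm (Y s - H \<zeta> s))\<^sup>2 \<partial>(lebesgue_on {a..t}))" for \<zeta>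
            unfolding mh_cost_def set_lebesgue_integral_restrict[OF interval]
            by (intro Bochner_Integration.integral_cong) (auto simp: H_def Y_def flow pert v_def[symmetric] w_def[symmetric])
          ultimately show "(\<exists>!\<xi>. \<xi> \<in> cball xa R \<and> local_solution (\<lambda>\<zeta>. mh_cost f h x0 a t \<zeta> u \<eta>) \<xi>) \<and>
             (\<forall>\<xi>. \<xi> \<in> cball xa R \<and> local_solution (\<lambda>\<zeta>. mh_cost f h x0 a t \<zeta> u \<eta>) \<xi> \<longrightarrow>
                norm (\<xi> - xa) \<le> K' * P * Theta_norm t T \<eta>)"
            using sol[OF Y_meas, of "P * \<theta>"] \<open>0 < P\<close> \<open>0 \<le> \<theta>\<close> by (simp add: \<theta>_def mult.assoc)
        qed
      qed
    qed
  qed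
qed

end
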